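(* Fix $\sigma>0$, $\mathsf{A}>0$ and $0<\alpha<\tfrac12$. Let $\mathsf{C}(\mathsf{A},\alpha\mathsf{A})=\sup I(X;Y)$, where $Y=X+Z$ with $Z\sim\mathcal{N}(0,\sigma^2)$ independent of $X$, and the supremum is over all distributions of $X$ with $X\ge0$ a.s., $\Pr[X>\mathsf{A}]=0$ and $\mathbb{E}[X]\le\alpha\mathsf{A}$. Let $\mu^*>0$ be the unique solution of $\alpha=\frac{1}{\mu^*}-\frac{e^{-\mu^*}}{1-e^{-\mu^*}}$. Then $$\mathsf{C}(\mathsf{A},\alpha\mathsf{A})\ge\frac12\log\left(1+\mathsf{A}^2\frac{e^{2\alpha\mu^*}}{2\pi e\sigma^2}\left(\frac{1-e^{-\mu^*}}{\mu^*}\right)^2\right),$$ $$\mathsf{C}(\mathsf{A},\alpha\mathsf{A})\le\frac12\log\left(1+\alpha(1-\alpha)\frac{\mathsf{A}^2}{\sigma^2}\right),$$ and, for every $\mu>0$ and every $\delta>0$, $$\begin{aligned}\mathsf{C}(\mathsf{A},\alpha\mathsf{A})\le{}&\left(1-\mathcal{Q}\!\left(\tfrac{\delta+\alpha\mathsf{A}}{\sigma}\right)-\mathcal{Q}\!\left(\tfrac{\delta+(1-\alpha)\mathsf{A}}{\sigma}\right)\right)\log\left(\frac{\mathsf{A}}{\sigma}\cdot\frac{e^{\mu\delta/\mathsf{A}}-e^{-\mu(1+\delta/\mathsf{A})}}{\sqrt{2\pi}\,\mu\left(1-2\mathcal{Q}(\delta/\sigma)\right)}\right)\\&-\frac12+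\mathcal{Q}\!\left(\tfrac{\delta}{\sigma}\right)+\frac{\delta}{\sqrt{2\pi}\sigma}e^{-\frac{\delta^2}{2\sigma^2}}+\frac{\sigma}{\mathsf{A}}\frac{\mu}{\sqrt{2\pi}}\left(e^{-\frac{\delta^2}{2\sigma^2}}-e^{-\frac{(\mathsf{A}+\delta)^2}{2\sigma^2}}\right)\\&+\mu\alpha\left(1-2\mathcal{Q}\!\left(\tfrac{\delta+\mathsf{A}/2}{\sigma}\right)\right).\end{aligned}$$
   Context: $\mathcal{Q}(\xi)=\int_\xi^\infty\frac{1}{\sqrt{2\pi}}e^{-t^2/2}\,dt$ for $\xi\in\mathbb{R}$ is the Gaussian Q-function. Logarithms are natural (capacity in nats). The channel is the free-space optical intensity channel with nonnegative input $X$, peak-power constraint $\mathsf{A}$, average-power constraint $\alpha\mathsf{A}$, and additive Gaussian noise of variance $\sigma^2$. *)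

theory Defs
  imports "HOL-Probability.Probability"
begin

definition Qfun :: "real \<Rightarrow> real" where
  "Qfun \<xi> = (LINT t:{\<xi>..}|lborel. (1 / sqrt (2 * pi)) * exp (- t\<^sup>2 / 2))"

definition admissible_input :: "real \<Rightarrow> real \<Rightarrow> real measure \<Rightarrow> bool" where
  "admissible_input A E P \<longleftrightarrow>
     prob_space P \<and> sets P = sets borel \<and>
     (AE x in P. 0 \<le> x) \<and> measure P {x. x > A} = 0 \<and>
     integrable P (\<lambda>x. x) \<and> (\<integral>x. x \<partial>P) \<le> E"

definition channel_space :: "real \<Rightarrow> real measure \<Rightarrow> (real \<times> real) measure" where
  "channel_space \<sigma> P = P \<Otimes>\<^sub>M density lborel (normal_density 0 \<sigma>)"

definition chan_MI :: "real \<Rightarrow> real measure \<Rightarrow> real" where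
  "chan_MI \<sigma> P = prob_space.mutual_information (channel_space \<sigma> P) (exp 1) borel borel
       fst (\<lambda>(x, z). x + z)"

definition capacity :: "real \<Rightarrow> real \<Rightarrow> real \<Rightarrow> ereal" where
  "capacity \<sigma> A E = (SUP P \<in> {P. admissible_input A E P}. ereal (chan_MI \<sigma> P))"

end

(*
  Duality gives the upper bounds: for the output density f and every density r, the mutual
  information E ln (w(Z) / f(X + Z)), with w the noise density, is at most
  E ln (w(Z) / r(X + Z)).  A Gaussian r gives the variance bound; an exponential r on
  [-\<delta>, A + \<delta>] with Gaussian tails gives the other one, where convexity of Q on the positive
  half-line replaces the input by its mean.

  The lower bound is the entropy power inequality for a truncated exponential input and Gaussian
  noise, proved by transport.  Let X = T(U) with U standard Gaussian and T increasing, and rotate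
  the independent standard Gaussians (U, Z / \<sigma>) into (U1, U2), with cosine c and sine s.  For
  fixed U2 the output X + Z is an increasing function of U1 with derivative c T'(U) + s \<sigma>, so a
  change of variables and Jensen's inequality give
  h(X + Z) >= h(U1) + E ln (c T'(U) + s \<sigma>), and weighted AM-GM with the best c finishes.
*)
theory Submission
  imports Defs
begin

section \<open>The channel, its output density and duality\<close>

text \<open>An admissible input need not have a Lebesgue density, so mutual information is written
  as a difference of two expectations in which the input enters only through its law and the mixture
  density of the output. The difference is legitimate because a bounded input keeps the logarithm of
  the output density within quadratic growth. Upper and lower bounds then rest on one inequality: E
  ln R <= 0 whenever R > 0 and E R <= 1. For the upper bounds R is r(Y) / f(Y); for the lower bound
  R compares f(Y) with the density of the rotated coordinate U1. The mean of the input is only known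
  to be at most \<alpha> A. The condition \<alpha> < 1/2 supplies the signs needed to pass to
  \<alpha> A: m (A - m) increases up to there, and the tangent at \<alpha> A of the probability that
  the output lies in [-\<delta>, A + \<delta>] has nonnegative slope. The truncated exponential law
  maximizes entropy on [0, A] for its mean, and the equation for its parameter fits that mean to
  \<alpha> A. Its quantile function is elementary, so the transport map is explicit.\<close>

definition noise :: "real \<Rightarrow> real measure" where
  "noise \<sigma> = density lborel (normal_density 0 \<sigma>)"

lemma sets_noise [simp, measurable_cong]: "sets (noise \<sigma>) = sets borel"
  and space_noise [simp]: "space (noise \<sigma>) = UNIV"
  by (simp_all add: noise_def)

lemma prob_space_noise: "\<sigma> > 0 \<Longrightarrow> prob_space (noise \<sigma>)"
  unfolding noise_def by (rule prob_space_normal_density)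

lemma noise_integrable:
  fixes g :: "real \<Rightarrow> real"
  assumes "g \<in> borel_measurable borel"
  shows "integrable (noise \<sigma>) g \<longleftrightarrow> integrable lborel (\<lambda>x. normal_density 0 \<sigma> x * g x)"
  unfolding noise_def using assms by (subst integrable_density) auto

lemma noise_integral:
  fixes g :: "real \<Rightarrow> real"
  assumes "g \<in> borel_measurable borel"
  shows "integral\<^sup>L (noise \<sigma>) g = (\<integral>x. normal_density 0 \<sigma> x * g x \<partial>lborel)"
  unfolding noise_def using assms by (subst integral_density) auto

lemma
  assumes "\<sigma> > 0"
  shows noise_integrable_ident: "integrable (noise \<sigma>) (\<lambda>z. z)"
    and noise_mean: "(\<integral>z. z \<partial>noise \<sigma>) = 0"
    and noise_integrable_square: "integrable (noise \<sigma>) (\<lambda>z. z\<^sup>2)"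
    and noise_second_moment: "(\<integral>z. z\<^sup>2 \<partial>noise \<sigma>) = \<sigma>\<^sup>2"
  using integral_normal_moment_nz_1[OF assms, of 0] integrable_normal_moment_nz_1[OF assms, of 0]
    integrable_normal_moment[OF assms, of 0 2] integral_normal_moment_even[OF assms, of 0 1]
  by (simp_all add: noise_integrable noise_integral)

lemma ln_normal_density:
  "\<sigma> > 0 \<Longrightarrow> ln (normal_density m \<sigma> x) = - ln (2 * pi * \<sigma>\<^sup>2) / 2 - (x - m)\<^sup>2 / (2 * \<sigma>\<^sup>2)"
  by (simp add: normal_density_def ln_mult ln_div ln_sqrt) (simp add: field_simps)

lemma (in pair_prob_space) integrable_pair_fst:
  fixes h :: "'a \<Rightarrow> real"
  assumes "integrable M1 h"
  shows "integrable (M1 \<Otimes>\<^sub>M M2) (\<lambda>x. h (fst x))"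
  by (rule integrable_distr[of fst _ M1]) (simp_all add: M2.distr_pair_fst assms)

lemma (in pair_prob_space) integrable_pair_snd:
  fixes h :: "'b \<Rightarrow> real"
  assumes "integrable M2 h"
  shows "integrable (M1 \<Otimes>\<^sub>M M2) (\<lambda>x. h (snd x))"
proof -
  interpret Q: pair_prob_space M2 M1 ..
  show ?thesis
    using Q.integrable_product_swap[OF Q.integrable_pair_fst[OF assms]]
    by (simp add: case_prod_unfold)
qed

lemma power2_add_le: "(a + b)\<^sup>2 \<le> 2 * a\<^sup>2 + 2 * (b::real)\<^sup>2"
  using zero_le_power2[of "a - b"] by (simp add: power2_eq_square algebra_simps)

locale bounded_input_channel =
  fixes \<sigma> A :: real and P :: "real measure"
  assumes sigma_pos: "\<sigma> > 0"
    and prob_input: "prob_space P"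
    and sets_input [simp, measurable_cong]: "sets P = sets borel"
    and input_range: "AE x in P. 0 \<le> x \<and> x \<le> A"
begin

section \<open>Output density: bounds, and integrability of its logarithm\<close>

definition out_density :: "real \<Rightarrow> real" where
  "out_density y = (\<integral>x. normal_density 0 \<sigma> (y - x) \<partial>P)"

sublocale input: prob_space P by (rule prob_input)
sublocale noise: prob_space "noise \<sigma>" by (rule prob_space_noise[OF sigma_pos])
sublocale pair: pair_prob_space P "noise \<sigma>" ..

lemma space_input [simp]: "space P = UNIV"
  using sets_eq_imp_space_eq[OF sets_input] by simp

lemma measure_input_UNIV [simp]: "measure P UNIV = 1"
  using input.prob_space by simp

lemma measure_noise_UNIV [simp]: "measure (noise \<sigma>) UNIV = 1"
  using noise.prob_space by simp

lemma channel_space_eq: "channel_space \<sigma> P = P \<Otimes>\<^sub>M noise \<sigma>"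
  by (simp add: channel_space_def noise_def)

lemma out_density_measurable [measurable]: "out_density \<in> borel_measurable borel"
  unfolding out_density_def by measurable

lemma normal_density_le: "normal_density 0 \<sigma> x \<le> 1 / sqrt (2 * pi * \<sigma>\<^sup>2)"
  unfolding normal_density_def using sigma_pos
  by (intro mult_left_le) (auto intro!: divide_nonpos_pos)

lemma integrable_transition: "integrable P (\<lambda>x. normal_density 0 \<sigma> (y - x))"
  by (rule input.integrable_const_bound[of _ "1 / sqrt (2 * pi * \<sigma>\<^sup>2)"])
     (auto simp: normal_density_le)

lemma nn_out_density: "(\<integral>\<^sup>+x. normal_density 0 \<sigma> (y - x) \<partial>P) = ennreal (out_density y)"
  unfolding out_density_def by (rule nn_integral_eq_integral[OF integrable_transition]) auto

lemma out_density_upper: "out_density y \<le> 1 / sqrt (2 * pi * \<sigma>\<^sup>2)"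
  unfolding out_density_def
  using integral_mono[OF integrable_transition, of "\<lambda>_. 1 / sqrt (2 * pi * \<sigma>\<^sup>2)" y]
  by (simp add: normal_density_le)

text \<open>For inputs in [0, A] one has (y - x)^2 <= 2 (y^2 + A^2), so every Gaussian in the
  mixture dominates one fixed Gaussian in y. This keeps the logarithm of the output density from
  falling faster than quadratically.\<close>

lemma out_density_lower:
  "1 / sqrt (2 * pi * \<sigma>\<^sup>2) * exp (- ((y\<^sup>2 + A\<^sup>2) / \<sigma>\<^sup>2)) \<le> out_density y"
proof -
  have "1 / sqrt (2 * pi * \<sigma>\<^sup>2) * exp (- ((y\<^sup>2 + A\<^sup>2) / \<sigma>\<^sup>2)) \<le> normal_density 0 \<sigma> (y - x)"
    if "0 \<le> x \<and> x \<le> A" for x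
  proof -
    have "x\<^sup>2 \<le> A\<^sup>2" using that by (simp add: power_mono)
    then have "(y - x)\<^sup>2 \<le> 2 * (y\<^sup>2 + A\<^sup>2)"
      using power2_add_le[of y "-x"] by simp
    then have "(y - x)\<^sup>2 / (2 * \<sigma>\<^sup>2) \<le> (y\<^sup>2 + A\<^sup>2) / \<sigma>\<^sup>2"
      using sigma_pos by (simp add: field_simps)
    then show ?thesis unfolding normal_density_def
      by (intro mult_left_mono) auto
  qed
  then have "(\<integral>x. 1 / sqrt (2 * pi * \<sigma>\<^sup>2) * exp (- ((y\<^sup>2 + A\<^sup>2) / \<sigma>\<^sup>2)) \<partial>P) \<le> out_density y"
    unfolding out_density_def using input_range
    by (intro integral_mono_AE integrable_transition) auto
  then show ?thesis by (simp add: input.prob_space)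
qed

lemma out_density_pos: "0 < out_density y"
  by (rule less_le_trans[OF _ out_density_lower]) (use sigma_pos in simp)

lemma out_density_neq_0 [simp]: "out_density y \<noteq> 0"
  using out_density_pos[of y] by simp

lemma ln_out_density_bound:
  "\<bar>ln (out_density y)\<bar> \<le> (\<bar>ln (sqrt (2 * pi * \<sigma>\<^sup>2))\<bar> + A\<^sup>2 / \<sigma>\<^sup>2) + (1 / \<sigma>\<^sup>2) * y\<^sup>2"
proof -
  let ?c = "sqrt (2 * pi * \<sigma>\<^sup>2)"
  have c: "?c > 0" using sigma_pos by simp
  have "ln (1 / ?c * exp (- ((y\<^sup>2 + A\<^sup>2) / \<sigma>\<^sup>2))) \<le> ln (out_density y)"
    using out_density_lower[of y] out_density_pos[of y] c by (subst ln_le_cancel_iff) simp_all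
  moreover have "ln (1 / ?c * exp (- ((y\<^sup>2 + A\<^sup>2) / \<sigma>\<^sup>2))) = - ln ?c - (y\<^sup>2 + A\<^sup>2) / \<sigma>\<^sup>2"
    using c by (subst ln_mult) (simp_all add: ln_div)
  moreover have "ln (out_density y) \<le> ln (1 / ?c)"
    using out_density_upper[of y] out_density_pos[of y] c by (subst ln_le_cancel_iff) simp_all
  moreover have "ln (1 / ?c) = - ln ?c" using c by (simp add: ln_div)
  moreover have "(y\<^sup>2 + A\<^sup>2) / \<sigma>\<^sup>2 = A\<^sup>2 / \<sigma>\<^sup>2 + (1 / \<sigma>\<^sup>2) * y\<^sup>2" by (simp add: add_divide_distrib)
  moreover have "0 \<le> A\<^sup>2 / \<sigma>\<^sup>2 + (1 / \<sigma>\<^sup>2) * y\<^sup>2" by simp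
  ultimately show ?thesis by linarith
qed

lemma AE_input_range: "AE p in P \<Otimes>\<^sub>M noise \<sigma>. 0 \<le> fst p \<and> fst p \<le> A"
proof -
  have "AE x in distr (P \<Otimes>\<^sub>M noise \<sigma>) P fst. 0 \<le> x \<and> x \<le> A"
    unfolding noise.distr_pair_fst by (rule input_range)
  from AE_distrD[OF measurable_fst this] show ?thesis .
qed

text \<open>The input is bounded and the noise has a second moment, so quadratic growth is exactly
  what the output can absorb.\<close>

lemma integrable_out:
  fixes g :: "real \<Rightarrow> real"
  assumes [measurable]: "g \<in> borel_measurable borel"
    and bound: "\<And>y. \<bar>g y\<bar> \<le> C + K * y\<^sup>2"
  shows "integrable (P \<Otimes>\<^sub>M noise \<sigma>) (\<lambda>p. g (fst p + snd p))"
proof (rule Bochner_Integration.integrable_bound)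
  show "integrable (P \<Otimes>\<^sub>M noise \<sigma>) (\<lambda>p. (C + 2 * \<bar>K\<bar> * A\<^sup>2) + 2 * \<bar>K\<bar> * (snd p)\<^sup>2)"
    using noise_integrable_square[OF sigma_pos]
    by (intro Bochner_Integration.integrable_add pair.integrable_pair_snd) simp_all
  show "AE p in P \<Otimes>\<^sub>M noise \<sigma>. norm (g (fst p + snd p))
      \<le> norm ((C + 2 * \<bar>K\<bar> * A\<^sup>2) + 2 * \<bar>K\<bar> * (snd p)\<^sup>2)"
    using AE_input_range
  proof eventually_elim
    case (elim p)
    have "(fst p)\<^sup>2 \<le> A\<^sup>2" using elim by (simp add: power_mono)
    then have "(fst p + snd p)\<^sup>2 \<le> 2 * A\<^sup>2 + 2 * (snd p)\<^sup>2"
      using power2_add_le[of "fst p" "snd p"] by simp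
    then have "\<bar>K\<bar> * (fst p + snd p)\<^sup>2 \<le> \<bar>K\<bar> * (2 * A\<^sup>2 + 2 * (snd p)\<^sup>2)"
      by (intro mult_left_mono) auto
    moreover have "K * (fst p + snd p)\<^sup>2 \<le> \<bar>K\<bar> * (fst p + snd p)\<^sup>2"
      by (intro mult_right_mono) auto
    ultimately have "\<bar>g (fst p + snd p)\<bar> \<le> (C + 2 * \<bar>K\<bar> * A\<^sup>2) + 2 * \<bar>K\<bar> * (snd p)\<^sup>2"
      using bound[of "fst p + snd p"] by (simp add: algebra_simps)
    then show ?case by simp
  qed
qed measurable

lemma integrable_ln_out: "integrable (P \<Otimes>\<^sub>M noise \<sigma>) (\<lambda>p. ln (out_density (fst p + snd p)))"
  by (rule integrable_out[OF _ ln_out_density_bound]) measurable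

lemma integrable_ln_noise: "integrable (noise \<sigma>) (\<lambda>z. ln (normal_density 0 \<sigma> z))"
  using sigma_pos noise_integrable_square[OF sigma_pos] by (simp add: ln_normal_density)

lemma integral_ln_noise:
  "(\<integral>z. ln (normal_density 0 \<sigma> z) \<partial>noise \<sigma>) = - ln (2 * pi * \<sigma>\<^sup>2) / 2 - 1 / 2"
  using sigma_pos noise_integrable_square[OF sigma_pos] noise_second_moment[OF sigma_pos]
  by (simp add: ln_normal_density noise.prob_space)

text \<open>The substitution y = x + z in the inner integral. It identifies the joint law of input
  and output as having density w(y - x) relative to the product of the input law and Lebesgue
  measure.\<close>

lemma nn_integral_joint:
  assumes [measurable]: "g \<in> borel_measurable (borel \<Otimes>\<^sub>M borel)"
  shows "(\<integral>\<^sup>+p. g (fst p, fst p + snd p) \<partial>(P \<Otimes>\<^sub>M noise \<sigma>))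
    = (\<integral>\<^sup>+p. ennreal (normal_density 0 \<sigma> (snd p - fst p)) * g p \<partial>(P \<Otimes>\<^sub>M lborel))"
proof -
  have "(\<integral>\<^sup>+p. g (fst p, fst p + snd p) \<partial>(P \<Otimes>\<^sub>M noise \<sigma>))
    = (\<integral>\<^sup>+x. \<integral>\<^sup>+z. g (x, x + z) \<partial>noise \<sigma> \<partial>P)"
    by (subst noise.nn_integral_fst[symmetric]) simp_all
  also have "\<dots> = (\<integral>\<^sup>+x. \<integral>\<^sup>+z. ennreal (normal_density 0 \<sigma> z) * g (x, x + z) \<partial>lborel \<partial>P)"
    unfolding noise_def by (subst nn_integral_density) simp_all
  also have "\<dots> = (\<integral>\<^sup>+x. \<integral>\<^sup>+y. ennreal (normal_density 0 \<sigma> (y - x)) * g (x, y) \<partial>lborel \<partial>P)"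
  proof (rule nn_integral_cong)
    fix x :: real
    show "(\<integral>\<^sup>+z. ennreal (normal_density 0 \<sigma> z) * g (x, x + z) \<partial>lborel)
      = (\<integral>\<^sup>+y. ennreal (normal_density 0 \<sigma> (y - x)) * g (x, y) \<partial>lborel)"
      by (subst nn_integral_real_affine[of _ 1 "-x"]) (simp_all add: add.commute[of "-x"])
  qed
  also have "\<dots> = (\<integral>\<^sup>+p. ennreal (normal_density 0 \<sigma> (snd p - fst p)) * g p \<partial>(P \<Otimes>\<^sub>M lborel))"
    by (subst lborel.nn_integral_fst[symmetric]) simp_all
  finally show ?thesis .
qed

lemma nn_integral_out:
  assumes [measurable]: "g \<in> borel_measurable borel"
  shows "(\<integral>\<^sup>+p. g (fst p + snd p) \<partial>(P \<Otimes>\<^sub>M noise \<sigma>)) = (\<integral>\<^sup>+y. ennreal (out_density y) * g y \<partial>lborel)"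
proof -
  interpret PL: pair_sigma_finite P lborel ..
  have "(\<integral>\<^sup>+p. g (fst p + snd p) \<partial>(P \<Otimes>\<^sub>M noise \<sigma>))
    = (\<integral>\<^sup>+p. ennreal (normal_density 0 \<sigma> (snd p - fst p)) * g (snd p) \<partial>(P \<Otimes>\<^sub>M lborel))"
    using nn_integral_joint[of "\<lambda>p. g (snd p)"] by simp
  also have "\<dots> = (\<integral>\<^sup>+y. \<integral>\<^sup>+x. ennreal (normal_density 0 \<sigma> (y - x)) * g y \<partial>P \<partial>lborel)"
    by (subst PL.nn_integral_snd[symmetric]) simp_all
  also have "\<dots> = (\<integral>\<^sup>+y. ennreal (out_density y) * g y \<partial>lborel)"
    by (simp add: nn_integral_multc nn_out_density)
  finally show ?thesis .
qed

text \<open>The reference measure for the input is its own law, with constant density 1. This covers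
  discrete and singular inputs as well.\<close>

lemma distributed_input: "distributed (P \<Otimes>\<^sub>M noise \<sigma>) P fst (\<lambda>_. ennreal 1)"
  unfolding distributed_def by (simp add: noise.distr_pair_fst density_1)

lemma distributed_joint:
  "distributed (P \<Otimes>\<^sub>M noise \<sigma>) (P \<Otimes>\<^sub>M lborel) (\<lambda>p. (fst p, fst p + snd p))
    (\<lambda>p. ennreal (normal_density 0 \<sigma> (snd p - fst p)))"
  unfolding distributed_def
proof (intro conjI measure_eqI)
  fix B assume "B \<in> sets (distr (P \<Otimes>\<^sub>M noise \<sigma>) (P \<Otimes>\<^sub>M lborel) (\<lambda>p. (fst p, fst p + snd p)))"
  then have [measurable]: "B \<in> sets (P \<Otimes>\<^sub>M lborel)" by simp
  have "sets (P \<Otimes>\<^sub>M (lborel :: real measure)) = sets (borel \<Otimes>\<^sub>M borel)"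
    by (intro sets_pair_measure_cong) simp_all
  then have [measurable]: "B \<in> sets (borel \<Otimes>\<^sub>M borel)" using \<open>B \<in> sets (P \<Otimes>\<^sub>M lborel)\<close> by simp
  have "emeasure (distr (P \<Otimes>\<^sub>M noise \<sigma>) (P \<Otimes>\<^sub>M lborel) (\<lambda>p. (fst p, fst p + snd p))) B
    = (\<integral>\<^sup>+p. indicator B (fst p, fst p + snd p) \<partial>(P \<Otimes>\<^sub>M noise \<sigma>))"
    by (subst nn_integral_indicator[symmetric], simp, subst nn_integral_distr) simp_all
  also have "\<dots> = (\<integral>\<^sup>+p. ennreal (normal_density 0 \<sigma> (snd p - fst p)) * indicator B p \<partial>(P \<Otimes>\<^sub>M lborel))"
    by (rule nn_integral_joint) measurable
  also have "\<dots> = emeasure (density (P \<Otimes>\<^sub>M lborel) (\<lambda>p. ennreal (normal_density 0 \<sigma> (snd p - fst p)))) B"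
    by (rule emeasure_density[symmetric]) measurable
  finally show "emeasure (distr (P \<Otimes>\<^sub>M noise \<sigma>) (P \<Otimes>\<^sub>M lborel) (\<lambda>p. (fst p, fst p + snd p))) B
    = emeasure (density (P \<Otimes>\<^sub>M lborel) (\<lambda>p. ennreal (normal_density 0 \<sigma> (snd p - fst p)))) B" .
qed simp_all

lemma distributed_out:
  "distributed (P \<Otimes>\<^sub>M noise \<sigma>) lborel (\<lambda>p. fst p + snd p) (\<lambda>y. ennreal (out_density y))"
  unfolding distributed_def
proof (intro conjI measure_eqI)
  fix B :: "real set"
  assume "B \<in> sets (distr (P \<Otimes>\<^sub>M noise \<sigma>) lborel (\<lambda>p. fst p + snd p))"
  then have [measurable]: "B \<in> sets borel" by simp
  have "emeasure (distr (P \<Otimes>\<^sub>M noise \<sigma>) lborel (\<lambda>p. fst p + snd p)) B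
    = (\<integral>\<^sup>+p. indicator B (fst p + snd p) \<partial>(P \<Otimes>\<^sub>M noise \<sigma>))"
    by (subst nn_integral_indicator[symmetric], simp, subst nn_integral_distr) simp_all
  also have "\<dots> = (\<integral>\<^sup>+y. ennreal (out_density y) * indicator B y \<partial>lborel)"
    by (rule nn_integral_out) measurable
  also have "\<dots> = emeasure (density lborel (\<lambda>y. ennreal (out_density y))) B"
    by (rule emeasure_density[symmetric]) simp_all
  finally show "emeasure (distr (P \<Otimes>\<^sub>M noise \<sigma>) lborel (\<lambda>p. fst p + snd p)) B
    = emeasure (density lborel (\<lambda>y. ennreal (out_density y))) B" .
qed simp_all

text \<open>This is I(X;Y) = h(Y) - h(Z). The information density is ln (w(y - x) / f(y)), and it
  may be split because both logarithms are integrable.\<close>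

theorem chan_MI_eq:
  "chan_MI \<sigma> P = (\<integral>z. ln (normal_density 0 \<sigma> z) \<partial>noise \<sigma>)
    - (\<integral>p. ln (out_density (fst p + snd p)) \<partial>(P \<Otimes>\<^sub>M noise \<sigma>))"
proof -
  let ?M = "P \<Otimes>\<^sub>M noise \<sigma>" and ?w = "normal_density 0 \<sigma>"
  interpret I: information_space ?M "exp 1" by unfold_locales simp
  interpret PL: pair_sigma_finite P lborel ..
  \<comment> \<open>The image measures depend only on the sigma-algebras of their targets, so the
    two copies of \<open>borel\<close> may be exchanged for \<open>P\<close> and
    \<open>lborel\<close>, the reference measures of the densities.\<close>
  have "chan_MI \<sigma> P = pair.mutual_information (exp 1) P lborel fst (\<lambda>p. fst p + snd p)"
    unfolding chan_MI_def channel_space_eq pair.mutual_information_def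
    by (intro arg_cong2[where f="KL_divergence (exp 1)"] arg_cong2[where f=pair_measure] distr_cong)
       (auto simp: split_beta intro!: sets_pair_measure_cong)
  also have "\<dots> = (\<integral>p. ?w (snd p - fst p) * log (exp 1) (?w (snd p - fst p) / (1 * out_density (snd p)))
      \<partial>(P \<Otimes>\<^sub>M lborel))"
    by (rule I.mutual_information_distr[OF _ _ distributed_input _ distributed_out _ distributed_joint])
       (auto simp: less_imp_le[OF out_density_pos] input.sigma_finite_measure_axioms
          lborel.sigma_finite_measure_axioms)
  also have "\<dots> = (\<integral>p. ln (?w (snd p - fst p) / out_density (snd p))
      \<partial>density (P \<Otimes>\<^sub>M lborel) (\<lambda>p. ennreal (?w (snd p - fst p))))"
    by (subst integral_density) (simp_all add: log_def)
  also have "\<dots> = (\<integral>p. ln (?w (snd p) / out_density (fst p + snd p)) \<partial>?M)"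
    unfolding distributed_distr_eq_density[OF distributed_joint, symmetric]
    by (subst integral_distr) simp_all
  also have "\<dots> = (\<integral>p. ln (?w (snd p)) - ln (out_density (fst p + snd p)) \<partial>?M)"
    using normal_density_pos[OF sigma_pos, of 0] by (simp add: ln_div less_imp_neq[symmetric])
  also have "\<dots> = (\<integral>p. ln (?w (snd p)) \<partial>?M) - (\<integral>p. ln (out_density (fst p + snd p)) \<partial>?M)"
    by (intro Bochner_Integration.integral_diff pair.integrable_pair_snd integrable_ln_noise integrable_ln_out)
  also have "(\<integral>p. ln (?w (snd p)) \<partial>?M) = (\<integral>z. ln (?w z) \<partial>noise \<sigma>)"
    using pair.integral_fst'[OF pair.integrable_pair_snd[OF integrable_ln_noise]]
    by (simp add: input.prob_space)
  finally show ?thesis .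
qed

text \<open>By ln x <= x - 1. This one inequality serves both the duality bound and the transport
  argument.\<close>

lemma (in prob_space) expectation_ln_le:
  assumes [measurable]: "R \<in> borel_measurable M"
    and pos: "\<And>x. x \<in> space M \<Longrightarrow> 0 < R x"
    and le: "(\<integral>\<^sup>+x. ennreal (R x) \<partial>M) \<le> 1"
    and int: "integrable M (\<lambda>x. ln (R x))"
  shows "(\<integral>x. ln (R x) \<partial>M) \<le> 0"
proof -
  have R: "integrable M R"
    using le pos by (intro integrableI_nonneg) (auto intro!: AE_I2 less_imp_le elim!: le_less_trans)
  have "(\<integral>\<^sup>+x. ennreal (R x) \<partial>M) = ennreal (\<integral>x. R x \<partial>M)"
    by (rule nn_integral_eq_integral[OF R]) (use pos less_imp_le in auto)
  then have "(\<integral>x. R x \<partial>M) \<le> 1" using le by (simp add: ennreal_le_1)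
  moreover have "(\<integral>x. ln (R x) \<partial>M) \<le> (\<integral>x. R x - 1 \<partial>M)"
    using R int pos by (intro integral_mono) (auto intro: ln_le_minus_one)
  ultimately show ?thesis using R by (simp add: prob_space)
qed

text \<open>E ln (f(Y) / r(Y)) is nonnegative as a relative entropy, also when \<open>r\<close> has
  mass below 1. The growth condition makes E ln r(Y) finite, so the ratio can be split. The constant
  in front is minus the entropy of the noise, and \<open>k x\<close> is any integrable bound on the
  cost of describing the output of input x by \<open>r\<close>.\<close>

theorem chan_MI_duality:
  fixes r :: "real \<Rightarrow> real"
  assumes [measurable]: "r \<in> borel_measurable borel"
    and pos: "\<And>y. 0 < r y" and sub: "(\<integral>\<^sup>+y. ennreal (r y) \<partial>lborel) \<le> 1"
    and growth: "\<And>y. \<bar>ln (r y)\<bar> \<le> C + K * y\<^sup>2"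
    and bound: "\<And>x. 0 \<le> x \<Longrightarrow> x \<le> A \<Longrightarrow> (\<integral>z. - ln (r (x + z)) \<partial>noise \<sigma>) \<le> k x"
    and k: "integrable P k"
  shows "chan_MI \<sigma> P \<le> - ln (2 * pi * \<sigma>\<^sup>2) / 2 - 1 / 2 + (\<integral>x. k x \<partial>P)"
proof -
  let ?M = "P \<Otimes>\<^sub>M noise \<sigma>"
  have int: "integrable ?M (\<lambda>p. ln (r (fst p + snd p)))"
    by (rule integrable_out[OF _ growth]) measurable
  have ln_ratio: "ln (r y / out_density y) = ln (r y) - ln (out_density y)" for y
    using pos[of y] by (simp add: ln_div)
  have "(\<integral>p. ln (r (fst p + snd p) / out_density (fst p + snd p)) \<partial>?M) \<le> 0"
  proof (rule pair.expectation_ln_le)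
    have r0: "r y \<noteq> 0" for y using pos[of y] by simp
    have "(\<integral>\<^sup>+p. ennreal (r (fst p + snd p) / out_density (fst p + snd p)) \<partial>?M)
      = (\<integral>\<^sup>+y. ennreal (out_density y) * ennreal (r y / out_density y) \<partial>lborel)"
      using nn_integral_out[of "\<lambda>y. ennreal (r y / out_density y)"] by simp
    also have "\<dots> = (\<integral>\<^sup>+y. ennreal (r y) \<partial>lborel)"
      by (intro nn_integral_cong) (simp add: r0 less_imp_le[OF out_density_pos] ennreal_mult'[symmetric])
    finally show "(\<integral>\<^sup>+p. ennreal (r (fst p + snd p) / out_density (fst p + snd p)) \<partial>?M) \<le> 1"
      using sub by simp
    show "integrable ?M (\<lambda>p. ln (r (fst p + snd p) / out_density (fst p + snd p)))"
      unfolding ln_ratio by (intro Bochner_Integration.integrable_diff int integrable_ln_out)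
  qed (use pos out_density_pos in auto)
  moreover have "(\<integral>p. ln (r (fst p + snd p) / out_density (fst p + snd p)) \<partial>?M)
    = (\<integral>p. ln (r (fst p + snd p)) \<partial>?M) - (\<integral>p. ln (out_density (fst p + snd p)) \<partial>?M)"
    unfolding ln_ratio by (intro Bochner_Integration.integral_diff int integrable_ln_out)
  moreover have "- (\<integral>p. ln (r (fst p + snd p)) \<partial>?M) \<le> (\<integral>x. k x \<partial>P)"
  proof -
    have neg: "integrable ?M (\<lambda>p. - ln (r (fst p + snd p)))" using int by simp
    have "- (\<integral>p. ln (r (fst p + snd p)) \<partial>?M) = (\<integral>p. - ln (r (fst p + snd p)) \<partial>?M)" by simp
    also have "\<dots> = (\<integral>x. (\<integral>z. - ln (r (x + z)) \<partial>noise \<sigma>) \<partial>P)"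
      using pair.integral_fst'[OF neg] by simp
    also have "\<dots> \<le> (\<integral>x. k x \<partial>P)"
    proof (rule integral_mono_AE)
      show "AE x in P. (\<integral>z. - ln (r (x + z)) \<partial>noise \<sigma>) \<le> k x"
        using input_range by eventually_elim (blast intro: bound)
    qed (use pair.integrable_fst'[OF neg] k in simp_all)
    finally show ?thesis .
  qed
  ultimately show ?thesis
    using chan_MI_eq integral_ln_noise by linarith
qed

end

lemma admissible_input_channel:
  assumes "\<sigma> > 0" "admissible_input A E P"
  shows "bounded_input_channel \<sigma> A P"
proof -
  interpret prob_space P using assms by (simp add: admissible_input_def)
  have s [measurable_cong]: "sets P = sets borel" using assms by (simp add: admissible_input_def)
  have "AE x in P. x \<notin> {x. x > A}"
    using assms(2) by (intro AE_not_in) (auto simp: admissible_input_def null_sets_def emeasure_eq_measure s)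
  then show ?thesis
    using assms unfolding bounded_input_channel_def admissible_input_def by (auto simp: not_less)
qed

section \<open>The variance bound\<close>

lemma admissible_moments:
  assumes "admissible_input A E P"
  shows "integrable P (\<lambda>x. x)" "integrable P (\<lambda>x. x\<^sup>2)" "0 \<le> (\<integral>x. x \<partial>P)"
    "(\<integral>x. x \<partial>P) \<le> E" "(\<integral>x. x\<^sup>2 \<partial>P) \<le> A * (\<integral>x. x \<partial>P)"
proof -
  \<comment> \<open>The noise level 1 is an arbitrary choice: only the facts about the range of the
    input are taken from the channel.\<close>
  interpret bounded_input_channel 1 A P
    by (rule admissible_input_channel[OF _ assms]) simp
  show int: "integrable P (\<lambda>x. x)" and "(\<integral>x. x \<partial>P) \<le> E"
    using assms by (simp_all add: admissible_input_def)
  have le: "AE x in P. x\<^sup>2 \<le> A * x"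
    using input_range by eventually_elim (simp add: power2_eq_square mult_right_mono)
  show int2: "integrable P (\<lambda>x. x\<^sup>2)"
  proof (rule Bochner_Integration.integrable_bound[of P "\<lambda>x. A * x"])
    show "AE x in P. norm (x\<^sup>2) \<le> norm (A * x)"
      using le
    proof eventually_elim
      case (elim x)
      then have "0 \<le> A * x" using zero_le_power2[of x] by linarith
      then show ?case using elim by (simp only: real_norm_def abs_of_nonneg zero_le_power2)
    qed
    show "integrable P (\<lambda>x. A * x)" using int by (rule integrable_mult_right)
    show "(\<lambda>x. x\<^sup>2) \<in> borel_measurable P" by measurable
  qed
  show "0 \<le> (\<integral>x. x \<partial>P)"
    proof (rule integral_nonneg_AE)
    show "AE x in P. 0 \<le> x" using input_range by eventually_elim simp
  qed
  show "(\<integral>x. x\<^sup>2 \<partial>P) \<le> A * (\<integral>x. x \<partial>P)"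
    using integral_mono_AE[OF int2 integrable_mult_right[OF int] le] by simp
qed

text \<open>The test Gaussian has the actual mean m of the input but the largest possible output
  variance \<open>v\<close>. The quadratic cost then averages to (Var X + \<sigma>^2) / (2 v) <=
  1/2, since x^2 <= A x gives Var X <= m (A - m).\<close>

theorem chan_MI_variance_bound:
  assumes "\<sigma> > 0" "A > 0" "0 < \<alpha>" "\<alpha> < 1/2" and adm: "admissible_input A (\<alpha> * A) P"
  shows "chan_MI \<sigma> P \<le> 1/2 * ln (1 + \<alpha> * (1 - \<alpha>) * A\<^sup>2 / \<sigma>\<^sup>2)"
proof -
  interpret bounded_input_channel \<sigma> A P
    by (rule admissible_input_channel[OF assms(1) adm])
  note mom = admissible_moments[OF adm]
  define m where "m = (\<integral>x. x \<partial>P)"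
  define v where "v = \<sigma>\<^sup>2 + \<alpha> * (1 - \<alpha>) * A\<^sup>2"
  have v: "v > 0" using assms by (auto simp: v_def intro!: add_pos_nonneg)
  have sv: "sqrt v > 0" "(sqrt v)\<^sup>2 = v" using v by simp_all
  have ln_r: "ln (normal_density m (sqrt v) y) = - ln (2 * pi * v) / 2 - (y - m)\<^sup>2 / (2 * v)" for y
    by (simp only: ln_normal_density[OF sv(1)] sv(2))
  have "chan_MI \<sigma> P \<le> - ln (2 * pi * \<sigma>\<^sup>2) / 2 - 1 / 2
    + (\<integral>x. ln (2 * pi * v) / 2 + ((x - m)\<^sup>2 + \<sigma>\<^sup>2) / (2 * v) \<partial>P)"
  proof (rule chan_MI_duality[where r = "normal_density m (sqrt v)"
        and C = "\<bar>ln (2 * pi * v)\<bar> / 2 + m\<^sup>2 / v" and K = "1 / v"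
        and k = "\<lambda>x. ln (2 * pi * v) / 2 + ((x - m)\<^sup>2 + \<sigma>\<^sup>2) / (2 * v)"])
    show "0 < normal_density m (sqrt v) y" for y
      by (rule normal_density_pos[OF sv(1)])
    show "(\<integral>\<^sup>+y. ennreal (normal_density m (sqrt v) y) \<partial>lborel) \<le> 1"
      using sv(1) by (subst nn_integral_eq_integral) simp_all
    show "\<bar>ln (normal_density m (sqrt v) y)\<bar> \<le> (\<bar>ln (2 * pi * v)\<bar> / 2 + m\<^sup>2 / v) + (1 / v) * y\<^sup>2" for y
    proof -
      have "(y - m)\<^sup>2 / (2 * v) \<le> (2 * y\<^sup>2 + 2 * m\<^sup>2) / (2 * v)"
        using power2_add_le[of y "-m"] v by (intro divide_right_mono) simp_all
      also have "\<dots> = m\<^sup>2 / v + (1 / v) * y\<^sup>2" using v by (simp add: field_simps)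
      finally have "(y - m)\<^sup>2 / (2 * v) \<le> m\<^sup>2 / v + (1 / v) * y\<^sup>2" .
      moreover have "0 \<le> (y - m)\<^sup>2 / (2 * v)" using v by simp
      moreover have "\<bar>- ln (2 * pi * v) / 2\<bar> = \<bar>ln (2 * pi * v)\<bar> / 2" by simp
      ultimately show ?thesis unfolding ln_r by linarith
    qed
    show "(\<integral>z. - ln (normal_density m (sqrt v) (x + z)) \<partial>noise \<sigma>)
      \<le> ln (2 * pi * v) / 2 + ((x - m)\<^sup>2 + \<sigma>\<^sup>2) / (2 * v)" for x
    proof -
      have "(\<integral>z. - ln (normal_density m (sqrt v) (x + z)) \<partial>noise \<sigma>)
        = (\<integral>z. (ln (2 * pi * v) / 2 + (x - m)\<^sup>2 / (2 * v)) + (x - m) / v * z + 1 / (2 * v) * z\<^sup>2 \<partial>noise \<sigma>)"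
        unfolding ln_r using v
        by (intro Bochner_Integration.integral_cong) (simp_all add: field_simps power2_eq_square)
      also have "\<dots> = (ln (2 * pi * v) / 2 + (x - m)\<^sup>2 / (2 * v)) + 1 / (2 * v) * \<sigma>\<^sup>2"
        using noise_integrable_ident[OF sigma_pos] noise_integrable_square[OF sigma_pos]
          noise_mean[OF sigma_pos] noise_second_moment[OF sigma_pos] by simp
      also have "\<dots> = ln (2 * pi * v) / 2 + ((x - m)\<^sup>2 + \<sigma>\<^sup>2) / (2 * v)"
        by (simp add: add_divide_distrib)
      finally show ?thesis by simp
    qed
    show "integrable P (\<lambda>x. ln (2 * pi * v) / 2 + ((x - m)\<^sup>2 + \<sigma>\<^sup>2) / (2 * v))"
      using mom(1,2) by (simp add: power2_diff)
  qed measurable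
  moreover have "(\<integral>x. ln (2 * pi * v) / 2 + ((x - m)\<^sup>2 + \<sigma>\<^sup>2) / (2 * v) \<partial>P)
    = ln (2 * pi * v) / 2 + ((\<integral>x. x\<^sup>2 \<partial>P) - m\<^sup>2 + \<sigma>\<^sup>2) / (2 * v)"
  proof -
    have "(\<integral>x. ln (2 * pi * v) / 2 + ((x - m)\<^sup>2 + \<sigma>\<^sup>2) / (2 * v) \<partial>P)
      = (\<integral>x. (ln (2 * pi * v) / 2 + (m\<^sup>2 + \<sigma>\<^sup>2) / (2 * v)) + 1 / (2 * v) * x\<^sup>2 - m / v * x \<partial>P)"
      using v by (intro Bochner_Integration.integral_cong) (simp_all add: field_simps power2_eq_square)
    also have "\<dots> = (ln (2 * pi * v) / 2 + (m\<^sup>2 + \<sigma>\<^sup>2) / (2 * v)) + 1 / (2 * v) * (\<integral>x. x\<^sup>2 \<partial>P) - m / v * m"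
      using mom(1,2) by (simp add: m_def)
    also have "\<dots> = ln (2 * pi * v) / 2 + ((\<integral>x. x\<^sup>2 \<partial>P) - m\<^sup>2 + \<sigma>\<^sup>2) / (2 * v)"
      using v by (simp add: field_simps power2_eq_square)
    finally show ?thesis .
  qed
  moreover have "((\<integral>x. x\<^sup>2 \<partial>P) - m\<^sup>2 + \<sigma>\<^sup>2) / (2 * v) \<le> 1 / 2"
  proof -
    have "(\<integral>x. x\<^sup>2 \<partial>P) - m\<^sup>2 \<le> m * (A - m)"
      using mom(5) by (simp add: m_def algebra_simps power2_eq_square)
    also have "\<dots> \<le> \<alpha> * (1 - \<alpha>) * A\<^sup>2"
    proof -
      have "m \<le> \<alpha> * A" using mom(4) by (simp add: m_def)
      moreover have "\<alpha> * A < A / 2" using assms mult_strict_right_mono[of \<alpha> "1/2" A] by simp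
      \<comment> \<open>The product is the increment of x (A - x) from m to \<alpha> A. Both points
        lie below A / 2, so the second factor is positive as well.\<close>
      ultimately have "0 \<le> (\<alpha> * A - m) * (A - (\<alpha> * A + m))" by (intro mult_nonneg_nonneg) linarith+
      also have "\<dots> = \<alpha> * (1 - \<alpha>) * A\<^sup>2 - m * (A - m)" by algebra
      finally show ?thesis by simp
    qed
    finally have "(\<integral>x. x\<^sup>2 \<partial>P) - m\<^sup>2 + \<sigma>\<^sup>2 \<le> v" by (simp add: v_def)
    then show ?thesis using v by (simp add: field_simps)
  qed
  moreover have "ln (v / \<sigma>\<^sup>2) = ln (2 * pi * v) - ln (2 * pi * \<sigma>\<^sup>2)"
    using v sigma_pos by (subst ln_divide_pos[symmetric]) simp_all
  ultimately have "chan_MI \<sigma> P \<le> 1/2 * ln (v / \<sigma>\<^sup>2)" by linarith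
  also have "v / \<sigma>\<^sup>2 = 1 + \<alpha> * (1 - \<alpha>) * A\<^sup>2 / \<sigma>\<^sup>2"
    using sigma_pos by (simp add: v_def add_divide_distrib)
  finally show ?thesis .
qed

section \<open>The Gaussian tail function\<close>

lemma std_normal_density_eq: "1 / sqrt (2 * pi) * exp (- x\<^sup>2 / 2) = std_normal_density x"
  by (simp add: std_normal_density_def)

lemma Qfun_eq: "Qfun \<xi> = (\<integral>t. indicator {\<xi>..} t * std_normal_density t \<partial>lborel)"
  unfolding Qfun_def set_lebesgue_integral_def std_normal_density_eq by simp

lemma normal_density_scale: "\<sigma> > 0 \<Longrightarrow> \<sigma> * normal_density 0 \<sigma> (\<sigma> * x) = std_normal_density x"
  by (simp add: normal_density_def real_sqrt_mult power_mult_distrib)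

lemma measure_noise_eq:
  assumes [measurable]: "B \<in> sets borel" and "\<sigma> > 0"
  shows "measure (noise \<sigma>) B = (\<integral>x. indicator B x * normal_density 0 \<sigma> x \<partial>lborel)"
proof -
  have "measure (noise \<sigma>) B = (\<integral>x. indicator B x \<partial>noise \<sigma>)" by simp
  also have "\<dots> = (\<integral>x. normal_density 0 \<sigma> x * indicator B x \<partial>lborel)"
    by (rule noise_integral) measurable
  finally show ?thesis by (simp add: mult.commute)
qed

lemma measure_noise_atLeast:
  assumes "\<sigma> > 0"
  shows "measure (noise \<sigma>) {a..} = Qfun (a / \<sigma>)"
proof -
  have "measure (noise \<sigma>) {a..} = (\<integral>x. indicator {a..} x * normal_density 0 \<sigma> x \<partial>lborel)"
    using assms by (intro measure_noise_eq) simp_all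
  also have "\<dots> = \<bar>\<sigma>\<bar> *\<^sub>R (\<integral>x. indicator {a..} (0 + \<sigma> * x) * normal_density 0 \<sigma> (0 + \<sigma> * x) \<partial>lborel)"
    using assms by (intro lborel_integral_real_affine) simp
  also have "\<dots> = (\<integral>x. indicator {a..} (\<sigma> * x) * (\<sigma> * normal_density 0 \<sigma> (\<sigma> * x)) \<partial>lborel)"
    using assms by (subst integral_scaleR_right[symmetric]) (simp add: mult_ac)
  also have "\<dots> = Qfun (a / \<sigma>)"
    unfolding Qfun_eq normal_density_scale[OF assms] using assms
    by (intro Bochner_Integration.integral_cong) (simp_all add: indicator_def field_simps)
  finally show ?thesis .
qed

lemma measure_noise_singleton: "measure (noise \<sigma>) {a} = 0"
proof -
  have "emeasure (noise \<sigma>) {a} = (\<integral>\<^sup>+x. ennreal (normal_density 0 \<sigma> x) * indicator {a} x \<partial>lborel)"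
    unfolding noise_def by (rule emeasure_density) simp_all
  also have "\<dots> = 0"
  proof (subst nn_integral_0_iff_AE)
    show "AE x in lborel. ennreal (normal_density 0 \<sigma> x) * indicator {a} x = 0"
      using AE_lborel_singleton[of a] by eventually_elim simp
  qed simp
  finally show ?thesis by (simp add: measure_def)
qed

context
  fixes \<sigma> :: real
  assumes pos: "\<sigma> > 0"
begin

interpretation noise: prob_space "noise \<sigma>" by (rule prob_space_noise[OF pos])

lemma measure_noise_greaterThan: "measure (noise \<sigma>) {a<..} = Qfun (a / \<sigma>)"
proof -
  have "measure (noise \<sigma>) {a..} = measure (noise \<sigma>) {a} + measure (noise \<sigma>) {a<..}"
    by (subst noise.finite_measure_Union[symmetric]) (auto intro!: arg_cong[where f="measure (noise \<sigma>)"])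
  then show ?thesis using pos by (simp add: measure_noise_singleton measure_noise_atLeast)
qed

lemma measure_noise_lessThan: "measure (noise \<sigma>) {..<a} = 1 - Qfun (a / \<sigma>)"
proof -
  have "measure (noise \<sigma>) (UNIV - {a..}) = 1 - measure (noise \<sigma>) {a..}"
    using noise.prob_compl[of "{a..}"] by simp
  moreover have "UNIV - {a..} = {..<a}" by auto
  ultimately show ?thesis using pos by (simp add: measure_noise_atLeast)
qed

lemma measure_noise_Icc: "a \<le> b \<Longrightarrow> measure (noise \<sigma>) {a..b} = Qfun (a / \<sigma>) - Qfun (b / \<sigma>)"
proof -
  assume "a \<le> b"
  then have "measure (noise \<sigma>) {a..} = measure (noise \<sigma>) {a..b} + measure (noise \<sigma>) {b<..}"
    by (subst noise.finite_measure_Union[symmetric]) (auto intro!: arg_cong[where f="measure (noise \<sigma>)"])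
  then show ?thesis using pos by (simp add: measure_noise_greaterThan measure_noise_atLeast)
qed

end

lemma Qfun_uminus: "Qfun (- x) = 1 - Qfun x"
proof -
  have "Qfun (- x) = \<bar>-1\<bar> *\<^sub>R (\<integral>t. indicator {-x..} (0 + (-1) * t) * std_normal_density (0 + (-1) * t) \<partial>lborel)"
    unfolding Qfun_eq by (rule lborel_integral_real_affine) simp
  also have "\<dots> = (\<integral>t. indicator {..x} t * std_normal_density t \<partial>lborel)"
    by (simp add: indicator_def normal_density_def)
  also have "\<dots> = measure (noise 1) {..x}"
    by (rule measure_noise_eq[symmetric]) simp_all
  also have "{..x} = {..<x} \<union> {x}" by auto
  also have "measure (noise 1) ({..<x} \<union> {x}) = 1 - Qfun x"
  proof -
    interpret noise: prob_space "noise 1" by (rule prob_space_noise) simp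
    show ?thesis by (subst noise.finite_measure_Union)
       (simp_all add: measure_noise_singleton measure_noise_lessThan)
  qed
  finally show ?thesis .
qed

lemma Qfun_0: "Qfun 0 = 1 / 2"
  using Qfun_uminus[of 0] by simp

lemma std_normal_density_decreasing: "0 \<le> x \<Longrightarrow> x \<le> y \<Longrightarrow> std_normal_density y \<le> std_normal_density x"
  unfolding std_normal_density_def by (intro mult_left_mono) (auto intro: power_mono)

lemma Qfun_diff:
  assumes "a \<le> b"
  shows "Qfun a - Qfun b = (\<integral>x. indicator {a..b} x * std_normal_density x \<partial>lborel)"
  using measure_noise_Icc[of 1 a b] measure_noise_eq[of "{a..b}" 1] assms by simp

lemma integrable_Icc_std_normal: "integrable lborel (\<lambda>x. indicator {a..b} x * std_normal_density x)"
  using integrable_mult_indicator[of "{a..b}" lborel std_normal_density] by simp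

lemma integrable_Icc_const: "integrable lborel (\<lambda>x. indicator {a..b} x * c :: real)" for a b c :: real
  by (intro integrable_mult_left integrable_real_indicator) (simp_all add: emeasure_lborel_Icc_eq)

text \<open>Convexity of Q on the nonnegative half-line, where its derivative, minus the Gaussian
  density, increases. The tangent form is the one that can be averaged over the input.\<close>

lemma Qfun_tangent:
  assumes "0 \<le> x" "0 \<le> y"
  shows "Qfun x - std_normal_density x * (y - x) \<le> Qfun y"
proof (cases "x \<le> y")
  case True
  have "Qfun x - Qfun y \<le> (\<integral>t. indicator {x..y} t * std_normal_density x \<partial>lborel)"
    unfolding Qfun_diff[OF True] using True assms
    by (intro integral_mono integrable_Icc_std_normal integrable_Icc_const)
       (auto simp: indicator_def std_normal_density_decreasing)
  then show ?thesis using True by (simp add: algebra_simps)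
next
  case False
  then have "y \<le> x" by simp
  have "(\<integral>t. indicator {y..x} t * std_normal_density x \<partial>lborel) \<le> Qfun y - Qfun x"
    unfolding Qfun_diff[OF \<open>y \<le> x\<close>] using \<open>y \<le> x\<close> assms
    by (intro integral_mono integrable_Icc_std_normal integrable_Icc_const)
       (auto simp: indicator_def std_normal_density_decreasing)
  then show ?thesis using \<open>y \<le> x\<close> by (simp add: algebra_simps)
qed

text \<open>The tangent at 0. It bounds the mass of the noise in [-\<delta>, \<delta>] from above,
  which is needed for the sign of the logarithm in the exponential bound.\<close>

lemma Qfun_ge_linear: "0 \<le> d \<Longrightarrow> 1 / 2 - d / sqrt (2 * pi) \<le> Qfun d"
  using Qfun_tangent[of 0 d] by (simp add: Qfun_0 std_normal_density_def)

lemma Qfun_strict_mono: "a < b \<Longrightarrow> Qfun b < Qfun a"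
proof -
  assume ab: "a < b"
  have c: "continuous_on {a..b} std_normal_density"
    unfolding std_normal_density_def[abs_def] by (intro continuous_intros) auto
  obtain c where c: "c \<in> {a..b}" "\<And>x. x \<in> {a..b} \<Longrightarrow> std_normal_density c \<le> std_normal_density x"
    using continuous_attains_inf[OF compact_Icc _ c] ab by auto
  have "(\<integral>t. indicator {a..b} t * std_normal_density c \<partial>lborel) \<le> Qfun a - Qfun b"
    unfolding Qfun_diff[OF less_imp_le[OF ab]] using ab c
    by (intro integral_mono integrable_Icc_std_normal integrable_Icc_const) (auto simp: indicator_def)
  moreover have "0 < (b - a) * std_normal_density c"
    using ab normal_density_pos[of 1 0 c] by simp
  ultimately show ?thesis using ab by simp
qed

lemma Qfun_nonneg: "0 \<le> Qfun x"
  using measure_noise_atLeast[of 1 x] measure_nonneg[of "noise 1" "{x..}"] by simp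

lemma Qfun_pos: "0 < Qfun x"
  using Qfun_strict_mono[of x "x + 1"] Qfun_nonneg[of "x + 1"] by simp

lemma Qfun_less_1: "Qfun x < 1"
  using Qfun_uminus[of x] Qfun_pos[of "-x"] by simp

text \<open>Around x, Q is a constant minus the indefinite integral of the density started at x - 1.
  The unit margins make x an interior point, so the derivative within the interval is a full
  derivative.\<close>

lemma Qfun_has_derivative: "(Qfun has_real_derivative - std_normal_density x) (at x)"
proof -
  let ?a = "x - 1" and ?b = "x + 1"
  have c: "continuous_on {?a..?b} std_normal_density"
    unfolding std_normal_density_def[abs_def] by (intro continuous_intros) auto
  have Q: "Qfun u = Qfun ?a - integral {?a..u} std_normal_density" if "u \<in> {?a..?b}" for u
  proof -
    have "set_integrable lborel {?a..u} std_normal_density"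
      unfolding set_integrable_def using integrable_Icc_std_normal by simp
    from set_borel_integral_eq_integral(2)[OF this] show ?thesis
      using Qfun_diff[of ?a u] that by (simp add: set_lebesgue_integral_def)
  qed
  have "((\<lambda>u. Qfun ?a - integral {?a..u} std_normal_density) has_real_derivative 0 - std_normal_density x)
      (at x within {?a..?b})"
    by (intro DERIV_diff DERIV_const integral_has_real_derivative c) simp
  then have "(Qfun has_real_derivative - std_normal_density x) (at x within {?a..?b})"
    unfolding diff_0
    by (rule has_field_derivative_transform_within[where d = 1]) (simp_all only: Q[symmetric], simp_all)
  then show ?thesis
    by (simp add: at_within_Icc_at)
qed

lemma Qfun_tendsto_at_top: "(Qfun \<longlongrightarrow> 0) at_top"
  and Qfun_tendsto_at_bot: "(Qfun \<longlongrightarrow> 1) at_bot"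
proof -
  interpret real_distribution "noise 1"
    using prob_space_noise[of 1] by (simp add: real_distribution_def real_distribution_axioms_def)
  have eq: "Qfun x = 1 - cdf (noise 1) x" for x
  proof -
    have "UNIV - {..x} = {x<..}" by auto
    then show ?thesis using prob_compl[of "{..x}"] measure_noise_greaterThan[of 1 x] by (simp add: cdf_def)
  qed
  show "(Qfun \<longlongrightarrow> 0) at_top"
    unfolding eq[abs_def] using tendsto_diff[OF tendsto_const cdf_lim_at_top_prob, of 1] by simp
  show "(Qfun \<longlongrightarrow> 1) at_bot"
    unfolding eq[abs_def] using tendsto_diff[OF tendsto_const cdf_lim_at_bot, of 1] by simp
qed

section \<open>Truncated moments of the noise\<close>

lemma DERIV_normal_density:
  assumes "\<sigma> > 0"
  shows "(normal_density 0 \<sigma> has_real_derivative - x / \<sigma>\<^sup>2 * normal_density 0 \<sigma> x) (at x)"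
  unfolding normal_density_def[abs_def] using assms
  by (auto intro!: derivative_eq_intros simp: field_simps power2_eq_square)

lemma continuous_on_normal_density: "\<sigma> > 0 \<Longrightarrow> continuous_on S (normal_density 0 \<sigma>)"
  using DERIV_normal_density by (meson DERIV_isCont continuous_at_imp_continuous_on)

lemma noise_Icc_mean:
  assumes "\<sigma> > 0" "a \<le> b"
  shows "(\<integral>z. indicator {a..b} z * z \<partial>noise \<sigma>) = \<sigma>\<^sup>2 * (normal_density 0 \<sigma> a - normal_density 0 \<sigma> b)"
proof -
  have "(\<integral>z. indicator {a..b} z * z \<partial>noise \<sigma>) = (\<integral>z. indicator {a..b} z *\<^sub>R (normal_density 0 \<sigma> z * z) \<partial>lborel)"
    by (subst noise_integral) (simp_all add: mult_ac)
  also have "\<dots> = - \<sigma>\<^sup>2 * normal_density 0 \<sigma> b - (- \<sigma>\<^sup>2 * normal_density 0 \<sigma> a)"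
  proof (rule integral_FTC_atLeastAtMost)
    fix x
    have "((\<lambda>x. - \<sigma>\<^sup>2 * normal_density 0 \<sigma> x) has_real_derivative normal_density 0 \<sigma> x * x) (at x)"
      using assms by (auto intro!: derivative_eq_intros DERIV_normal_density)
    then show "((\<lambda>x. - \<sigma>\<^sup>2 * normal_density 0 \<sigma> x) has_vector_derivative normal_density 0 \<sigma> x * x)
        (at x within {a..b})"
      by (simp add: has_real_derivative_iff_has_vector_derivative has_vector_derivative_at_within)
  qed (use assms in \<open>auto intro!: continuous_intros continuous_on_normal_density\<close>)
  finally show ?thesis by (simp add: algebra_simps)
qed

lemma integrable_noise_indicator:
  assumes "integrable (noise \<sigma>) g" "B \<in> sets borel"
  shows "integrable (noise \<sigma>) (\<lambda>z. indicator B z * g z :: real)"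
  using integrable_mult_indicator[of B "noise \<sigma>" g] assms by simp

text \<open>Integration by parts: (- \<sigma>^2 z w(z))' = z^2 w(z) - \<sigma>^2 w(z). The second
  moment over [-\<delta>, \<delta>] is subtracted from the full one. Divided by 2 \<sigma>^2, the
  result gives the terms Q(\<delta> / \<sigma>) and \<delta> w(\<delta>) of the exponential
  bound.\<close>

lemma noise_tail_second_moment:
  assumes "\<sigma> > 0" "\<delta> > 0"
  shows "(\<integral>z. z\<^sup>2 - indicator {-\<delta>..\<delta>} z * z\<^sup>2 \<partial>noise \<sigma>)
    = 2 * \<sigma>\<^sup>2 * (Qfun (\<delta> / \<sigma>) + \<delta> * normal_density 0 \<sigma> \<delta>)"
proof -
  let ?w = "normal_density 0 \<sigma>"
  have w: "integrable lborel (\<lambda>z. indicator {-\<delta>..\<delta>} z *\<^sub>R (?w z * z\<^sup>2))"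
    by (rule borel_integrable_atLeastAtMost'[unfolded set_integrable_def])
       (use assms in \<open>auto intro!: continuous_intros continuous_on_normal_density\<close>)
  have i: "integrable lborel (\<lambda>z. indicator {-\<delta>..\<delta>} z *\<^sub>R ?w z)"
    by (rule borel_integrable_atLeastAtMost'[unfolded set_integrable_def])
       (use assms in \<open>auto intro!: continuous_intros continuous_on_normal_density\<close>)
  have "(\<integral>z. indicator {-\<delta>..\<delta>} z *\<^sub>R (?w z * z\<^sup>2 - \<sigma>\<^sup>2 * ?w z) \<partial>lborel)
    = - \<sigma>\<^sup>2 * \<delta> * ?w \<delta> - (- \<sigma>\<^sup>2 * (- \<delta>) * ?w (- \<delta>))"
  proof (rule integral_FTC_atLeastAtMost)
    fix x
    have "((\<lambda>x. - \<sigma>\<^sup>2 * x * ?w x) has_real_derivative ?w x * x\<^sup>2 - \<sigma>\<^sup>2 * ?w x) (at x)"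
      using assms by (auto intro!: derivative_eq_intros DERIV_normal_density simp: power2_eq_square)
    then show "((\<lambda>x. - \<sigma>\<^sup>2 * x * ?w x) has_vector_derivative ?w x * x\<^sup>2 - \<sigma>\<^sup>2 * ?w x)
        (at x within {-\<delta>..\<delta>})"
      by (simp add: has_real_derivative_iff_has_vector_derivative has_vector_derivative_at_within)
  qed (use assms in \<open>auto intro!: continuous_intros continuous_on_normal_density\<close>)
  then have F: "(\<integral>z. indicator {-\<delta>..\<delta>} z *\<^sub>R (?w z * z\<^sup>2 - \<sigma>\<^sup>2 * ?w z) \<partial>lborel) = - 2 * \<sigma>\<^sup>2 * \<delta> * ?w \<delta>"
    by (simp add: normal_density_def)
  have D: "(\<integral>z. indicator {-\<delta>..\<delta>} z *\<^sub>R (?w z * z\<^sup>2 - \<sigma>\<^sup>2 * ?w z) \<partial>lborel)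
    = (\<integral>z. indicator {-\<delta>..\<delta>} z *\<^sub>R (?w z * z\<^sup>2) \<partial>lborel)
      - \<sigma>\<^sup>2 * (\<integral>z. indicator {-\<delta>..\<delta>} z *\<^sub>R ?w z \<partial>lborel)"
  proof -
    have "(\<integral>z. indicator {-\<delta>..\<delta>} z *\<^sub>R (?w z * z\<^sup>2 - \<sigma>\<^sup>2 * ?w z) \<partial>lborel)
      = (\<integral>z. indicator {-\<delta>..\<delta>} z *\<^sub>R (?w z * z\<^sup>2) - \<sigma>\<^sup>2 * (indicator {-\<delta>..\<delta>} z *\<^sub>R ?w z) \<partial>lborel)"
      by (intro Bochner_Integration.integral_cong) (simp_all add: algebra_simps)
    also have "\<dots> = (\<integral>z. indicator {-\<delta>..\<delta>} z *\<^sub>R (?w z * z\<^sup>2) \<partial>lborel)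
      - (\<integral>z. \<sigma>\<^sup>2 * (indicator {-\<delta>..\<delta>} z *\<^sub>R ?w z) \<partial>lborel)"
      by (intro Bochner_Integration.integral_diff w integrable_mult_right i)
    finally show ?thesis by simp
  qed
  have I: "(\<integral>z. indicator {-\<delta>..\<delta>} z *\<^sub>R ?w z \<partial>lborel) = 1 - 2 * Qfun (\<delta> / \<sigma>)"
  proof -
    have "(\<integral>z. indicator {-\<delta>..\<delta>} z *\<^sub>R ?w z \<partial>lborel) = measure (noise \<sigma>) {-\<delta>..\<delta>}"
      using assms by (subst measure_noise_eq) simp_all
    then show ?thesis
      using assms by (simp add: measure_noise_Icc Qfun_uminus)
  qed
  have N: "(\<integral>z. indicator {-\<delta>..\<delta>} z * z\<^sup>2 \<partial>noise \<sigma>)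
    = (\<integral>z. indicator {-\<delta>..\<delta>} z *\<^sub>R (?w z * z\<^sup>2) \<partial>lborel)"
    by (subst noise_integral) (simp_all add: mult_ac)
  have S: "(\<integral>z. z\<^sup>2 - indicator {-\<delta>..\<delta>} z * z\<^sup>2 \<partial>noise \<sigma>)
    = (\<integral>z. z\<^sup>2 \<partial>noise \<sigma>) - (\<integral>z. indicator {-\<delta>..\<delta>} z * z\<^sup>2 \<partial>noise \<sigma>)"
    using noise_integrable_square[OF assms(1)]
    by (intro Bochner_Integration.integral_diff integrable_noise_indicator) simp_all
  show ?thesis
    using F unfolding S N D I noise_second_moment[OF assms(1)] by (simp add: algebra_simps)
qed

text \<open>The probability that input x produces an output in [-\<delta>, A + \<delta>], the range
  of the exponential piece of the test density.\<close>

definition mid_prob :: "real \<Rightarrow> real \<Rightarrow> real \<Rightarrow> real \<Rightarrow> real" where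
  "mid_prob \<sigma> A \<delta> x = 1 - Qfun ((\<delta> + x) / \<sigma>) - Qfun ((\<delta> + A - x) / \<sigma>)"

lemma mid_prob_eq:
  assumes "\<sigma> > 0" "A > 0" "\<delta> > 0"
  shows "measure (noise \<sigma>) {- \<delta> - x..A + \<delta> - x} = mid_prob \<sigma> A \<delta> x"
proof -
  have "(- \<delta> - x) / \<sigma> = - ((\<delta> + x) / \<sigma>)"
    by (metis minus_divide_left minus_add_distrib diff_conv_add_uminus)
  then show ?thesis
    using assms by (simp add: measure_noise_Icc mid_prob_def Qfun_uminus add_ac)
qed

text \<open>On [0, A] both arguments of Q are positive, so convexity of Q makes this probability
  concave in x. A tangent bound is affine in x, and its average depends on the input only through
  the mean.\<close>

lemma mid_prob_tangent:
  assumes "\<sigma> > 0" "\<delta> > 0" "0 \<le> x" "x \<le> A" "0 \<le> t" "t \<le> A"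
  shows "mid_prob \<sigma> A \<delta> x \<le> mid_prob \<sigma> A \<delta> t
    + (std_normal_density ((\<delta> + t) / \<sigma>) - std_normal_density ((\<delta> + A - t) / \<sigma>)) / \<sigma> * (x - t)"
proof -
  have "Qfun ((\<delta> + t) / \<sigma>) - std_normal_density ((\<delta> + t) / \<sigma>) * ((\<delta> + x) / \<sigma> - (\<delta> + t) / \<sigma>)
      \<le> Qfun ((\<delta> + x) / \<sigma>)"
    using assms by (intro Qfun_tangent) simp_all
  moreover have "Qfun ((\<delta> + A - t) / \<sigma>) - std_normal_density ((\<delta> + A - t) / \<sigma>)
      * ((\<delta> + A - x) / \<sigma> - (\<delta> + A - t) / \<sigma>) \<le> Qfun ((\<delta> + A - x) / \<sigma>)"
    using assms by (intro Qfun_tangent) simp_all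
  moreover have "(\<delta> + x) / \<sigma> - (\<delta> + t) / \<sigma> = (x - t) / \<sigma>"
    "(\<delta> + A - x) / \<sigma> - (\<delta> + A - t) / \<sigma> = - ((x - t) / \<sigma>)"
    using assms by (simp_all add: field_simps)
  ultimately show ?thesis by (simp add: mid_prob_def algebra_simps diff_divide_distrib)
qed

text \<open>By symmetry about A / 2 the tangent there is horizontal.\<close>

lemma mid_prob_le_centre:
  assumes "\<sigma> > 0" "\<delta> > 0" "0 \<le> x" "x \<le> A"
  shows "mid_prob \<sigma> A \<delta> x \<le> 1 - 2 * Qfun ((\<delta> + A / 2) / \<sigma>)"
proof -
  have "\<delta> + A - A / 2 = \<delta> + A / 2" by simp
  then show ?thesis
    using mid_prob_tangent[OF assms, of "A / 2"] assms by (simp only: mid_prob_def) simp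
qed

text \<open>This is sinh t >= t: the derivative of the difference is the square of exp (x / 2) - exp
  (- x / 2). With t = \<mu> \<delta> / A it pairs with the tangent of Q at 0 to show that the
  logarithm below is nonnegative.\<close>

lemma exp_diff_ge: "0 \<le> t \<Longrightarrow> 2 * t \<le> exp t - exp (- t)" for t :: real
proof -
  assume "0 \<le> t"
  then have "(\<lambda>t. exp t - exp (- t) - 2 * t) 0 \<le> (\<lambda>t. exp t - exp (- t) - 2 * t) t"
  proof (rule DERIV_nonneg_imp_nondecreasing)
    fix x :: real
    have "0 \<le> (exp (x / 2) - exp (- x / 2))\<^sup>2" by simp
    also have "\<dots> = exp x + exp (- x) - 2"
      by (simp add: power2_eq_square algebra_simps flip: exp_add)
    finally show "\<exists>y. ((\<lambda>t. exp t - exp (- t) - 2 * t) has_real_derivative y) (at x) \<and> 0 \<le> y"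
      by (intro exI[of _ "exp x + exp (- x) - 2"]) (auto intro!: derivative_eq_intros)
  qed
  then show ?thesis by simp
qed

text \<open>The logarithm in the third bound is nonnegative, so its coefficient may be enlarged.\<close>

lemma log_argument_ge_1:
  assumes "\<sigma> > 0" "A > 0" "\<mu> > 0" "\<delta> > 0"
  shows "1 \<le> A / \<sigma> * (exp (\<mu> * \<delta> / A) - exp (- \<mu> * (1 + \<delta> / A)))
    / (sqrt (2 * pi) * \<mu> * (1 - 2 * Qfun (\<delta> / \<sigma>)))"
proof -
  have q: "0 < 1 - 2 * Qfun (\<delta> / \<sigma>)"
    using Qfun_strict_mono[of 0 "\<delta> / \<sigma>"] assms by (simp add: Qfun_0)
  have "sqrt (2 * pi) * (1 - 2 * Qfun (\<delta> / \<sigma>)) \<le> sqrt (2 * pi) * (2 * (\<delta> / \<sigma>) / sqrt (2 * pi))"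
    using Qfun_ge_linear[of "\<delta> / \<sigma>"] assms by (intro mult_left_mono) auto
  also have "\<dots> = 2 * (\<delta> / \<sigma>)" by simp
  finally have "sqrt (2 * pi) * (1 - 2 * Qfun (\<delta> / \<sigma>)) * \<mu> \<le> 2 * (\<delta> / \<sigma>) * \<mu>"
    using assms by (intro mult_right_mono) simp_all
  also have "\<dots> = A / \<sigma> * (2 * (\<mu> * \<delta> / A))" using assms by (simp add: field_simps)
  also have "\<dots> \<le> A / \<sigma> * (exp (\<mu> * \<delta> / A) - exp (- (\<mu> * \<delta> / A)))"
    using assms by (intro mult_left_mono exp_diff_ge) simp_all
  also have "\<dots> \<le> A / \<sigma> * (exp (\<mu> * \<delta> / A) - exp (- \<mu> * (1 + \<delta> / A)))"
    using assms by (intro mult_left_mono diff_left_mono) (simp_all add: algebra_simps)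
  finally have "sqrt (2 * pi) * \<mu> * (1 - 2 * Qfun (\<delta> / \<sigma>))
    \<le> A / \<sigma> * (exp (\<mu> * \<delta> / A) - exp (- \<mu> * (1 + \<delta> / A)))" by (simp only: mult_ac)
  moreover have "0 < sqrt (2 * pi) * \<mu> * (1 - 2 * Qfun (\<delta> / \<sigma>))" using q assms by simp
  ultimately show ?thesis by (simp only: le_divide_eq_1_pos)
qed

section \<open>The exponential bound\<close>

lemma nn_integral_indicator_normal:
  assumes "\<sigma> > 0" "B \<in> sets borel"
  shows "(\<integral>\<^sup>+y. ennreal (normal_density 0 \<sigma> y) * indicator B y \<partial>lborel) = ennreal (measure (noise \<sigma>) B)"
proof -
  interpret prob_space "noise \<sigma>" by (rule prob_space_noise[OF assms(1)])
  have "(\<integral>\<^sup>+y. ennreal (normal_density 0 \<sigma> y) * indicator B y \<partial>lborel) = emeasure (noise \<sigma>) B"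
    unfolding noise_def using assms(2) by (intro emeasure_density[symmetric]) simp_all
  then show ?thesis by (simp only: emeasure_eq_measure)
qed

lemma noise_integrable_growth:
  fixes g :: "real \<Rightarrow> real"
  assumes "\<sigma> > 0" and [measurable]: "g \<in> borel_measurable borel"
    and growth: "\<And>y. \<bar>g y\<bar> \<le> C + K * y\<^sup>2"
  shows "integrable (noise \<sigma>) (\<lambda>z. g (x + z))"
proof (rule Bochner_Integration.integrable_bound)
  interpret prob_space "noise \<sigma>" by (rule prob_space_noise[OF assms(1)])
  show "integrable (noise \<sigma>) (\<lambda>z. (C + \<bar>K\<bar> * (2 * x\<^sup>2)) + \<bar>K\<bar> * (2 * z\<^sup>2))"
    using noise_integrable_square[OF assms(1)] by simp
  show "AE z in noise \<sigma>. norm (g (x + z)) \<le> norm ((C + \<bar>K\<bar> * (2 * x\<^sup>2)) + \<bar>K\<bar> * (2 * z\<^sup>2))"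
  proof (rule AE_I2)
    fix z
    have "K * (x + z)\<^sup>2 \<le> \<bar>K\<bar> * (x + z)\<^sup>2"
      by (intro mult_right_mono) simp_all
    also have "\<dots> \<le> \<bar>K\<bar> * (2 * x\<^sup>2 + 2 * z\<^sup>2)"
      by (intro mult_left_mono power2_add_le) simp
    finally have "\<bar>g (x + z)\<bar> \<le> (C + \<bar>K\<bar> * (2 * x\<^sup>2)) + \<bar>K\<bar> * (2 * z\<^sup>2)"
      using growth[of "x + z"] by (simp add: algebra_simps)
    then show "norm (g (x + z)) \<le> norm ((C + \<bar>K\<bar> * (2 * x\<^sup>2)) + \<bar>K\<bar> * (2 * z\<^sup>2))"
      unfolding real_norm_def by linarith
  qed
qed measurable

locale exponential_output =
  fixes \<sigma> A \<mu> \<delta> :: real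
  assumes sigma_pos: "\<sigma> > 0" and A_pos: "A > 0" and mu_pos: "\<mu> > 0" and delta_pos: "\<delta> > 0"
begin

abbreviation w :: "real \<Rightarrow> real" where "w \<equiv> normal_density 0 \<sigma>"

text \<open>The integral of exp (- \<mu> y / A) over [-\<delta>, A + \<delta>], multiplied by \<mu>
  / A.\<close>

definition E :: real where "E = exp (\<mu> * \<delta> / A) - exp (- \<mu> * (1 + \<delta> / A))"

text \<open>The probability that the noise lies in [-\<delta>, \<delta>]; the two Gaussian tails of
  the test density use up the rest.\<close>

definition q :: real where "q = 1 - 2 * Qfun (\<delta> / \<sigma>)"

text \<open>Normalizes the exponential piece to mass \<open>q\<close>.\<close>

definition rate :: real where "rate = q * \<mu> / (A * E)"

definition L :: real where "L = ln (A / \<sigma> * E / (sqrt (2 * pi) * \<mu> * q))"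

text \<open>The tails are those of the output for the extreme inputs 0 and A. For any other input,
  an output beyond either end requires a noise value at least as large as the one the tail charges
  for.\<close>

definition r :: "real \<Rightarrow> real" where
  "r y = (if y < - \<delta> then w y else if y \<le> A + \<delta> then rate * exp (- \<mu> * y / A) else w (y - A))"

lemma r_measurable [measurable]: "r \<in> borel_measurable borel"
  unfolding r_def[abs_def] by measurable

lemma q_pos: "q > 0"
  using Qfun_strict_mono[of 0 "\<delta> / \<sigma>"] sigma_pos delta_pos by (simp add: Qfun_0 q_def)

lemma E_pos: "E > 0"
proof -
  have "- \<mu> * (1 + \<delta> / A) < 0" "0 < \<mu> * \<delta> / A"
    using mu_pos delta_pos A_pos by (simp_all add: add_pos_pos mult_neg_pos)
  then show ?thesis unfolding E_def by simp
qed

lemma rate_pos: "rate > 0"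
  unfolding rate_def using q_pos E_pos A_pos mu_pos by simp

lemma L_nonneg: "0 \<le> L"
  using log_argument_ge_1[OF sigma_pos A_pos mu_pos delta_pos] unfolding L_def E_def q_def
  by (rule ln_ge_zero)

lemma r_pos: "0 < r y"
  using rate_pos normal_density_pos[OF sigma_pos] by (simp add: r_def)

lemma exponential_mass:
  "(\<integral>\<^sup>+y. ennreal (rate * exp (- \<mu> * y / A)) * indicator {-\<delta>..A + \<delta>} y \<partial>lborel) = ennreal q"
proof -
  let ?F = "\<lambda>y. - (rate * A / \<mu>) * exp (- \<mu> * y / A)"
  have "(\<integral>\<^sup>+y. ennreal (rate * exp (- \<mu> * y / A)) * indicator {-\<delta>..A + \<delta>} y \<partial>lborel)
    = ennreal (?F (A + \<delta>) - ?F (- \<delta>))"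
  proof (rule nn_integral_FTC_Icc)
    show "(\<lambda>y. rate * exp (- \<mu> * y / A)) \<in> borel_measurable borel" by measurable
    fix x
    show "(?F has_real_derivative rate * exp (- \<mu> * x / A)) (at x)"
      using mu_pos A_pos by (auto intro!: derivative_eq_intros)
    show "0 \<le> rate * exp (- \<mu> * x / A)" using rate_pos by simp
  qed (use A_pos delta_pos in simp)
  also have "?F (A + \<delta>) - ?F (- \<delta>) = rate * A / \<mu> * E"
  proof -
    have "- \<mu> * (A + \<delta>) / A = - \<mu> * (1 + \<delta> / A)" using A_pos by (simp add: field_simps)
    moreover have "- \<mu> * (- \<delta>) / A = \<mu> * \<delta> / A" by simp
    ultimately show ?thesis unfolding E_def by (simp only:) (simp add: algebra_simps)
  qed
  also have "rate * A / \<mu> * E = q"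
    unfolding rate_def using A_pos mu_pos E_pos by simp
  finally show ?thesis .
qed

lemma r_mass: "(\<integral>\<^sup>+y. ennreal (r y) \<partial>lborel) \<le> 1"
proof -
  have "(\<integral>\<^sup>+y. ennreal (r y) \<partial>lborel) = (\<integral>\<^sup>+y. ennreal (w y) * indicator {..<-\<delta>} y
      + ennreal (rate * exp (- \<mu> * y / A)) * indicator {-\<delta>..A + \<delta>} y
      + ennreal (w (y - A)) * indicator {A + \<delta><..} y \<partial>lborel)"
    using A_pos delta_pos by (intro nn_integral_cong) (auto simp: r_def indicator_def)
  also have "\<dots> = (\<integral>\<^sup>+y. ennreal (w y) * indicator {..<-\<delta>} y \<partial>lborel)
      + (\<integral>\<^sup>+y. ennreal (rate * exp (- \<mu> * y / A)) * indicator {-\<delta>..A + \<delta>} y \<partial>lborel)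
      + (\<integral>\<^sup>+y. ennreal (w (y - A)) * indicator {A + \<delta><..} y \<partial>lborel)"
  proof -
    have m: "(\<lambda>y. ennreal (w y) * indicator {..<-\<delta>} y) \<in> borel_measurable lborel"
      "(\<lambda>y. ennreal (rate * exp (- \<mu> * y / A)) * indicator {-\<delta>..A + \<delta>} y) \<in> borel_measurable lborel"
      "(\<lambda>y. ennreal (w (y - A)) * indicator {A + \<delta><..} y) \<in> borel_measurable lborel"
      by measurable
    show ?thesis
      by (simp only: nn_integral_add m borel_measurable_add)
  qed
  finally have split: "(\<integral>\<^sup>+y. ennreal (r y) \<partial>lborel) = (\<integral>\<^sup>+y. ennreal (w y) * indicator {..<-\<delta>} y \<partial>lborel)
      + (\<integral>\<^sup>+y. ennreal (rate * exp (- \<mu> * y / A)) * indicator {-\<delta>..A + \<delta>} y \<partial>lborel)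
      + (\<integral>\<^sup>+y. ennreal (w (y - A)) * indicator {A + \<delta><..} y \<partial>lborel)" .
  have left: "(\<integral>\<^sup>+y. ennreal (w y) * indicator {..<-\<delta>} y \<partial>lborel) = ennreal (Qfun (\<delta> / \<sigma>))"
    using sigma_pos
    by (simp add: nn_integral_indicator_normal measure_noise_lessThan Qfun_uminus)
  have "(\<integral>\<^sup>+y. ennreal (w (y - A)) * indicator {A + \<delta><..} y \<partial>lborel)
    = (\<integral>\<^sup>+y. ennreal (w y) * indicator {\<delta><..} y \<partial>lborel)"
    by (subst nn_integral_real_affine[of _ 1 A]) (simp_all add: indicator_def)
  also have "\<dots> = ennreal (Qfun (\<delta> / \<sigma>))"
    using sigma_pos by (simp add: nn_integral_indicator_normal measure_noise_greaterThan)
  finally have right: "(\<integral>\<^sup>+y. ennreal (w (y - A)) * indicator {A + \<delta><..} y \<partial>lborel)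
    = ennreal (Qfun (\<delta> / \<sigma>))" .
  have "ennreal (Qfun (\<delta> / \<sigma>)) + ennreal q + ennreal (Qfun (\<delta> / \<sigma>)) = 1"
    using q_pos by (simp add: Qfun_nonneg q_def flip: ennreal_plus)
  then show ?thesis unfolding split left right exponential_mass by simp
qed

lemma ln_r:
  "ln (r y) = (if y < - \<delta> then - ln (2 * pi * \<sigma>\<^sup>2) / 2 - y\<^sup>2 / (2 * \<sigma>\<^sup>2)
    else if y \<le> A + \<delta> then ln rate - \<mu> / A * y
    else - ln (2 * pi * \<sigma>\<^sup>2) / 2 - (y - A)\<^sup>2 / (2 * \<sigma>\<^sup>2))"
  unfolding r_def using rate_pos by (simp add: ln_normal_density[OF sigma_pos] ln_mult)

text \<open>The term ln (2 pi \<sigma>^2) / 2 is split off because it cancels against the entropy of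
  the noise in the duality bound; what survives is the logarithm of the theorem.\<close>

lemma ln_rate: "- ln rate = ln (2 * pi * \<sigma>\<^sup>2) / 2 + L"
proof -
  have "ln (2 * pi * \<sigma>\<^sup>2) / 2 = ln (sqrt (2 * pi) * \<sigma>)"
    using sigma_pos by (simp add: ln_sqrt[symmetric] real_sqrt_mult)
  moreover have "L = ln (inverse rate / (sqrt (2 * pi) * \<sigma>))"
    unfolding L_def rate_def using sigma_pos A_pos mu_pos by (simp add: field_simps)
  moreover have "ln (inverse rate / (sqrt (2 * pi) * \<sigma>)) = - ln rate - ln (sqrt (2 * pi) * \<sigma>)"
    using sigma_pos rate_pos by (subst ln_divide_pos) (simp_all add: ln_inverse)
  ultimately show ?thesis by simp
qed

lemma ln_r_growth:
  "\<bar>ln (r y)\<bar> \<le> (\<bar>ln (2 * pi * \<sigma>\<^sup>2) / 2\<bar> + \<bar>ln rate\<bar> + \<mu> / A * (A + \<delta>) + A\<^sup>2 / \<sigma>\<^sup>2) + (1 / \<sigma>\<^sup>2) * y\<^sup>2"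
proof -
  have nn: "0 \<le> \<mu> / A * (A + \<delta>)" "0 \<le> A\<^sup>2 / \<sigma>\<^sup>2" "0 \<le> (1 / \<sigma>\<^sup>2) * y\<^sup>2"
    using mu_pos A_pos delta_pos by simp_all
  have left: "0 \<le> y\<^sup>2 / (2 * \<sigma>\<^sup>2)" "y\<^sup>2 / (2 * \<sigma>\<^sup>2) \<le> (1 / \<sigma>\<^sup>2) * y\<^sup>2"
    using sigma_pos by (simp_all add: field_simps)
  have "(y - A)\<^sup>2 / (2 * \<sigma>\<^sup>2) \<le> (2 * y\<^sup>2 + 2 * A\<^sup>2) / (2 * \<sigma>\<^sup>2)"
    using power2_add_le[of y "-A"] by (intro divide_right_mono) simp_all
  also have "\<dots> = (1 / \<sigma>\<^sup>2) * y\<^sup>2 + A\<^sup>2 / \<sigma>\<^sup>2" using sigma_pos by (simp add: field_simps)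
  finally have right: "(y - A)\<^sup>2 / (2 * \<sigma>\<^sup>2) \<le> (1 / \<sigma>\<^sup>2) * y\<^sup>2 + A\<^sup>2 / \<sigma>\<^sup>2" .
  have right0: "0 \<le> (y - A)\<^sup>2 / (2 * \<sigma>\<^sup>2)" by simp
  have mid: "\<bar>\<mu> / A * y\<bar> \<le> \<mu> / A * (A + \<delta>)" if "\<not> y < - \<delta>" "y \<le> A + \<delta>"
  proof -
    have "\<bar>y\<bar> \<le> A + \<delta>" using that A_pos delta_pos by linarith
    moreover have "\<bar>\<mu> / A * y\<bar> = \<mu> / A * \<bar>y\<bar>"
      using mu_pos A_pos by (simp add: abs_mult)
    ultimately show ?thesis
      using mu_pos A_pos by (simp only:) (intro mult_left_mono, simp_all)
  qed
  have aux: "\<bar>- ln (2 * pi * \<sigma>\<^sup>2) / 2 - a\<bar> \<le> \<bar>ln (2 * pi * \<sigma>\<^sup>2) / 2\<bar> + a" if "0 \<le> a" for a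
    using that by linarith
  consider "y < - \<delta>" | "\<not> y < - \<delta>" "y \<le> A + \<delta>" | "\<not> y < - \<delta>" "\<not> y \<le> A + \<delta>" by blast
  then show ?thesis
  proof cases
    case 1
    then show ?thesis
      unfolding ln_r if_P[OF 1] using nn left aux[OF left(1)] by linarith
  next
    case 2
    then show ?thesis
      unfolding ln_r if_not_P[OF 2(1)] if_P[OF 2(2)] using nn mid[OF 2] by linarith
  next
    case 3
    then show ?thesis
      unfolding ln_r if_not_P[OF 3(1)] if_not_P[OF 3(2)] using nn right aux[OF right0] by linarith
  qed
qed

text \<open>If x + z < -\<delta>, then x >= 0 gives (x + z)^2 <= z^2 and z < -\<delta>; the right
  end is symmetric with A - x >= 0. So a tail output costs at most z^2 / (2 \<sigma>^2) on the event
  |z| > \<delta>, which is free of x. For middle outputs this extra term is only nonnegative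
  slack.\<close>

lemma minus_ln_r_le:
  assumes "0 \<le> x" "x \<le> A"
  shows "- ln (r (x + z)) \<le> ln (2 * pi * \<sigma>\<^sup>2) / 2
    + indicator {- \<delta> - x..A + \<delta> - x} z * (L + \<mu> / A * x)
    + \<mu> / A * (indicator {- \<delta> - x..A + \<delta> - x} z * z)
    + 1 / (2 * \<sigma>\<^sup>2) * (z\<^sup>2 - indicator {-\<delta>..\<delta>} z * z\<^sup>2)"
proof -
  have sq: "0 \<le> 1 / (2 * \<sigma>\<^sup>2) * (z\<^sup>2 - indicator {-\<delta>..\<delta>} z * z\<^sup>2)"
    by (simp add: indicator_def)
  consider "x + z < - \<delta>" | "- \<delta> \<le> x + z" "x + z \<le> A + \<delta>" | "A + \<delta> < x + z" by linarith
  then show ?thesis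
  proof cases
    case 1
    then have i: "indicator {- \<delta> - x..A + \<delta> - x} z = (0::real)" "indicator {-\<delta>..\<delta>} z = (0::real)"
      using assms by (simp_all add: indicator_def)
    have "(- (x + z))\<^sup>2 \<le> (- z)\<^sup>2" using 1 assms delta_pos by (intro power_mono) simp_all
    then have "(x + z)\<^sup>2 \<le> z\<^sup>2" by (simp only: power2_minus)
    then have "(x + z)\<^sup>2 / (2 * \<sigma>\<^sup>2) \<le> 1 / (2 * \<sigma>\<^sup>2) * z\<^sup>2"
      using divide_right_mono[of "(x + z)\<^sup>2" "z\<^sup>2" "2 * \<sigma>\<^sup>2"] by simp
    then show ?thesis using 1 unfolding ln_r i by simp
  next
    case 2
    then have i: "indicator {- \<delta> - x..A + \<delta> - x} z = (1::real)"
      by (simp add: indicator_def)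
    have "- ln (r (x + z)) = ln (2 * pi * \<sigma>\<^sup>2) / 2 + L + \<mu> / A * (x + z)"
      using 2 ln_rate by (simp add: ln_r)
    also have "\<dots> = ln (2 * pi * \<sigma>\<^sup>2) / 2 + 1 * (L + \<mu> / A * x) + \<mu> / A * (1 * z)"
      by (simp add: distrib_left)
    finally show ?thesis using sq unfolding i by linarith
  next
    case 3
    then have i: "indicator {- \<delta> - x..A + \<delta> - x} z = (0::real)" "indicator {-\<delta>..\<delta>} z = (0::real)"
      using assms by (simp_all add: indicator_def)
    have "(x + z - A)\<^sup>2 \<le> z\<^sup>2" using 3 assms delta_pos by (intro power_mono) simp_all
    then have "(x + z - A)\<^sup>2 / (2 * \<sigma>\<^sup>2) \<le> 1 / (2 * \<sigma>\<^sup>2) * z\<^sup>2"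
      using divide_right_mono[of "(x + z - A)\<^sup>2" "z\<^sup>2" "2 * \<sigma>\<^sup>2"] by simp
    then show ?thesis using 3 A_pos delta_pos unfolding ln_r i by simp
  qed
qed

text \<open>The density decreases away from 0, so x = 0 is the worst input; it gives the right-hand
  side with equality.\<close>

lemma normal_edge_le:
  assumes "0 \<le> x" "x \<le> A"
  shows "w (\<delta> + x) - w (A + \<delta> - x) \<le> w \<delta> - w (A + \<delta>)"
proof -
  have mono: "w b \<le> w a" if "0 \<le> a" "a \<le> b" for a b
    unfolding normal_density_def using that
    by (intro mult_left_mono) (auto intro!: divide_right_mono power_mono)
  show ?thesis using mono[of \<delta> "\<delta> + x"] mono[of "A + \<delta> - x" "A + \<delta>"] assms delta_pos by simp
qed

text \<open>The point of the form is that the bound is affine in x, so averaging over the input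
  needs its mean alone. Here \<open>s\<close> is the slope of the tangent to \<open>mid_prob\<close>
  at t.\<close>

lemma minus_ln_r_expectation:
  assumes "0 \<le> x" "x \<le> A" "0 \<le> t" "t \<le> A"
  defines "s \<equiv> (std_normal_density ((\<delta> + t) / \<sigma>) - std_normal_density ((\<delta> + A - t) / \<sigma>)) / \<sigma>"
  shows "(\<integral>z. - ln (r (x + z)) \<partial>noise \<sigma>) \<le> ln (2 * pi * \<sigma>\<^sup>2) / 2
    + L * (mid_prob \<sigma> A \<delta> t + s * (x - t)) + \<mu> / A * (1 - 2 * Qfun ((\<delta> + A / 2) / \<sigma>)) * x
    + \<mu> / A * \<sigma>\<^sup>2 * (w \<delta> - w (A + \<delta>)) + (Qfun (\<delta> / \<sigma>) + \<delta> * w \<delta>)"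
proof -
  interpret noise: prob_space "noise \<sigma>" by (rule prob_space_noise[OF sigma_pos])
  have noise_univ: "measure (noise \<sigma>) UNIV = 1" using noise.prob_space by simp
  let ?I = "\<lambda>z. indicator {- \<delta> - x..A + \<delta> - x} z :: real"
  have I1: "integrable (noise \<sigma>) (\<lambda>z. ?I z * c)" for c
    by (intro integrable_noise_indicator) simp_all
  have I2: "integrable (noise \<sigma>) (\<lambda>z. ?I z * z)"
    using noise_integrable_ident[OF sigma_pos] by (intro integrable_noise_indicator) simp_all
  have I3: "integrable (noise \<sigma>) (\<lambda>z. z\<^sup>2 - indicator {-\<delta>..\<delta>} z * z\<^sup>2)"
    using noise_integrable_square[OF sigma_pos]
    by (intro Bochner_Integration.integrable_diff integrable_noise_indicator) simp_all
  have I4: "integrable (noise \<sigma>) (\<lambda>z. - ln (r (x + z)))"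
  proof (rule noise_integrable_growth[OF sigma_pos])
    show "(\<lambda>y. - ln (r y)) \<in> borel_measurable borel" by measurable
    show "\<bar>- ln (r y)\<bar> \<le> (\<bar>ln (2 * pi * \<sigma>\<^sup>2) / 2\<bar> + \<bar>ln rate\<bar> + \<mu> / A * (A + \<delta>) + A\<^sup>2 / \<sigma>\<^sup>2)
      + (1 / \<sigma>\<^sup>2) * y\<^sup>2" for y
      unfolding abs_minus_cancel by (rule ln_r_growth)
  qed
  have "(\<integral>z. - ln (r (x + z)) \<partial>noise \<sigma>) \<le> (\<integral>z. ln (2 * pi * \<sigma>\<^sup>2) / 2
    + ?I z * (L + \<mu> / A * x) + \<mu> / A * (?I z * z)
    + 1 / (2 * \<sigma>\<^sup>2) * (z\<^sup>2 - indicator {-\<delta>..\<delta>} z * z\<^sup>2) \<partial>noise \<sigma>)"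
    by (intro integral_mono I4 Bochner_Integration.integrable_add I1 integrable_mult_right I2 I3
        noise.integrable_const minus_ln_r_le assms)
  also have "\<dots> = ln (2 * pi * \<sigma>\<^sup>2) / 2 + (\<integral>z. ?I z * (L + \<mu> / A * x) \<partial>noise \<sigma>)
    + \<mu> / A * (\<integral>z. ?I z * z \<partial>noise \<sigma>)
    + 1 / (2 * \<sigma>\<^sup>2) * (\<integral>z. z\<^sup>2 - indicator {-\<delta>..\<delta>} z * z\<^sup>2 \<partial>noise \<sigma>)"
    by (simp only: Bochner_Integration.integral_add Bochner_Integration.integrable_add I1
        integrable_mult_right I2 I3 noise.integrable_const integral_mult_right_zero
        lebesgue_integral_const space_noise noise_univ scaleR_one)
  finally have le: "(\<integral>z. - ln (r (x + z)) \<partial>noise \<sigma>) \<le> ln (2 * pi * \<sigma>\<^sup>2) / 2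
    + (\<integral>z. ?I z * (L + \<mu> / A * x) \<partial>noise \<sigma>) + \<mu> / A * (\<integral>z. ?I z * z \<partial>noise \<sigma>)
    + 1 / (2 * \<sigma>\<^sup>2) * (\<integral>z. z\<^sup>2 - indicator {-\<delta>..\<delta>} z * z\<^sup>2 \<partial>noise \<sigma>)" .
  have J1: "(\<integral>z. ?I z * (L + \<mu> / A * x) \<partial>noise \<sigma>) = mid_prob \<sigma> A \<delta> x * (L + \<mu> / A * x)"
    using mid_prob_eq[OF sigma_pos A_pos delta_pos, of x] by simp
  have J2: "(\<integral>z. ?I z * z \<partial>noise \<sigma>) = \<sigma>\<^sup>2 * (w (\<delta> + x) - w (A + \<delta> - x))"
  proof -
    have "w (- \<delta> - x) = w (\<delta> + x)" by (simp add: normal_density_def power2_eq_square algebra_simps)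
    then show ?thesis using A_pos delta_pos by (subst noise_Icc_mean[OF sigma_pos]) simp_all
  qed
  have J3: "1 / (2 * \<sigma>\<^sup>2) * (\<integral>z. z\<^sup>2 - indicator {-\<delta>..\<delta>} z * z\<^sup>2 \<partial>noise \<sigma>)
    = Qfun (\<delta> / \<sigma>) + \<delta> * w \<delta>"
    unfolding noise_tail_second_moment[OF sigma_pos delta_pos] using sigma_pos by simp
  note main = le[unfolded J1 J2 J3]
  \<comment> \<open>Replacing the probability by its tangent is an upper bound only because its
    coefficient \<open>L\<close> is nonnegative.\<close>
  have "L * mid_prob \<sigma> A \<delta> x \<le> L * (mid_prob \<sigma> A \<delta> t + s * (x - t))"
    unfolding s_def using assms(1-4)
    by (intro mult_left_mono mid_prob_tangent L_nonneg sigma_pos delta_pos)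
  \<comment> \<open>The product of x with the probability is not affine; bounding the probability by
    its value at the centre restores affinity and produces the last factor of the theorem.\<close>
  moreover have "\<mu> / A * x * mid_prob \<sigma> A \<delta> x \<le> \<mu> / A * x * (1 - 2 * Qfun ((\<delta> + A / 2) / \<sigma>))"
    using assms(1-4) mu_pos A_pos
    by (intro mult_left_mono mid_prob_le_centre sigma_pos delta_pos) simp_all
  moreover have "\<mu> / A * (\<sigma>\<^sup>2 * (w (\<delta> + x) - w (A + \<delta> - x))) \<le> \<mu> / A * (\<sigma>\<^sup>2 * (w \<delta> - w (A + \<delta>)))"
    using assms(1-4) mu_pos A_pos by (intro mult_left_mono normal_edge_le) simp_all
  moreover have "mid_prob \<sigma> A \<delta> x * (L + \<mu> / A * x)
    = L * mid_prob \<sigma> A \<delta> x + \<mu> / A * x * mid_prob \<sigma> A \<delta> x" by (simp add: algebra_simps)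
  moreover have "\<mu> / A * x * (1 - 2 * Qfun ((\<delta> + A / 2) / \<sigma>))
    = \<mu> / A * (1 - 2 * Qfun ((\<delta> + A / 2) / \<sigma>)) * x" by simp
  moreover have "\<mu> / A * (\<sigma>\<^sup>2 * (w \<delta> - w (A + \<delta>))) = \<mu> / A * \<sigma>\<^sup>2 * (w \<delta> - w (A + \<delta>))" by simp
  ultimately show ?thesis using main by linarith
qed

end

text \<open>The tangent is taken at t = \<alpha> A, the largest mean allowed. The averaged affine
  bound at the actual mean is at most its value at t, where the tangent is exact.\<close>

theorem chan_MI_exponential_bound:
  assumes "\<sigma> > 0" "A > 0" "0 < \<alpha>" "\<alpha> < 1/2" "\<mu> > 0" "\<delta> > 0"
    and adm: "admissible_input A (\<alpha> * A) P"
  shows "chan_MI \<sigma> P \<le>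
       (1 - Qfun ((\<delta> + \<alpha> * A) / \<sigma>) - Qfun ((\<delta> + (1 - \<alpha>) * A) / \<sigma>))
         * ln (A / \<sigma> * (exp (\<mu> * \<delta> / A) - exp (- \<mu> * (1 + \<delta> / A)))
               / (sqrt (2 * pi) * \<mu> * (1 - 2 * Qfun (\<delta> / \<sigma>))))
       - 1/2 + Qfun (\<delta> / \<sigma>) + \<delta> / (sqrt (2 * pi) * \<sigma>) * exp (- \<delta>\<^sup>2 / (2 * \<sigma>\<^sup>2))
       + \<sigma> / A * \<mu> / sqrt (2 * pi) * (exp (- \<delta>\<^sup>2 / (2 * \<sigma>\<^sup>2)) - exp (- (A + \<delta>)\<^sup>2 / (2 * \<sigma>\<^sup>2)))
       + \<mu> * \<alpha> * (1 - 2 * Qfun ((\<delta> + A / 2) / \<sigma>))"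
proof -
  interpret bounded_input_channel \<sigma> A P
    by (rule admissible_input_channel[OF assms(1) adm])
  interpret X: exponential_output \<sigma> A \<mu> \<delta>
    using assms by unfold_locales
  note mom = admissible_moments[OF adm]
  define m where "m = (\<integral>x. x \<partial>P)"
  define t where "t = \<alpha> * A"
  define s where "s = (std_normal_density ((\<delta> + t) / \<sigma>) - std_normal_density ((\<delta> + A - t) / \<sigma>)) / \<sigma>"
  define c where "c = 1 - 2 * Qfun ((\<delta> + A / 2) / \<sigma>)"
  define D where "D = \<mu> / A * \<sigma>\<^sup>2 * (X.w \<delta> - X.w (A + \<delta>)) + (Qfun (\<delta> / \<sigma>) + \<delta> * X.w \<delta>)"
  let ?k = "\<lambda>x. ln (2 * pi * \<sigma>\<^sup>2) / 2 + X.L * (mid_prob \<sigma> A \<delta> t + s * (x - t)) + \<mu> / A * c * x + D"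
  have "t < A / 2" using assms mult_strict_right_mono[of \<alpha> "1/2" A] by (simp add: t_def)
  moreover have "0 < t" using assms by (simp add: t_def)
  ultimately have t: "0 \<le> t" "t \<le> A" "t \<le> A - t" by linarith+
  \<comment> \<open>Since t lies in the left half of [0, A], moving right raises the probability of
    the middle range, so the tangent slope is nonnegative. This is where \<alpha> < 1/2
    acts.\<close>
  have "std_normal_density ((\<delta> + A - t) / \<sigma>) \<le> std_normal_density ((\<delta> + t) / \<sigma>)"
    using t assms by (intro std_normal_density_decreasing divide_right_mono) simp_all
  then have s: "0 \<le> s" using assms by (simp add: s_def)
  have c: "0 \<le> c"
    using Qfun_strict_mono[of 0 "(\<delta> + A / 2) / \<sigma>"] assms by (simp add: c_def Qfun_0)
  have "?k = (\<lambda>x. (ln (2 * pi * \<sigma>\<^sup>2) / 2 + X.L * (mid_prob \<sigma> A \<delta> t - s * t) + D)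
      + (X.L * s + \<mu> / A * c) * x)"
    by (simp add: algebra_simps)
  moreover have "integrable P (\<lambda>x. (ln (2 * pi * \<sigma>\<^sup>2) / 2 + X.L * (mid_prob \<sigma> A \<delta> t - s * t) + D)
      + (X.L * s + \<mu> / A * c) * x)"
    by (intro Bochner_Integration.integrable_add integrable_mult_right mom(1) input.integrable_const)
  moreover have "(\<integral>x. (ln (2 * pi * \<sigma>\<^sup>2) / 2 + X.L * (mid_prob \<sigma> A \<delta> t - s * t) + D)
      + (X.L * s + \<mu> / A * c) * x \<partial>P)
    = (ln (2 * pi * \<sigma>\<^sup>2) / 2 + X.L * (mid_prob \<sigma> A \<delta> t - s * t) + D) + (X.L * s + \<mu> / A * c) * m"
    by (subst Bochner_Integration.integral_add)
      (simp_all only: integrable_mult_right mom(1) input.integrable_const lebesgue_integral_const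
        space_input measure_input_UNIV integral_mult_right_zero m_def scaleR_one)
  ultimately have k: "integrable P ?k" and int_k: "(\<integral>x. ?k x \<partial>P) =
      (ln (2 * pi * \<sigma>\<^sup>2) / 2 + X.L * (mid_prob \<sigma> A \<delta> t - s * t) + D) + (X.L * s + \<mu> / A * c) * m"
    by metis+
  have "chan_MI \<sigma> P \<le> - ln (2 * pi * \<sigma>\<^sup>2) / 2 - 1 / 2 + (\<integral>x. ?k x \<partial>P)"
  proof (rule chan_MI_duality[OF X.r_measurable X.r_pos X.r_mass X.ln_r_growth _ k])
    fix x assume "0 \<le> x" "x \<le> A"
    from X.minus_ln_r_expectation[OF this t(1,2)]
    show "(\<integral>z. - ln (X.r (x + z)) \<partial>noise \<sigma>) \<le> ?k x"
      unfolding s_def c_def D_def by linarith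
  qed
  \<comment> \<open>The total slope is nonnegative, so the mean constraint, an inequality, may be
    replaced by equality.\<close>
  moreover have "(X.L * s + \<mu> / A * c) * m \<le> (X.L * s + \<mu> / A * c) * t"
    using mom(4) s c X.L_nonneg assms by (intro mult_left_mono) (simp_all add: m_def t_def)
  ultimately have "chan_MI \<sigma> P \<le> - 1 / 2 + X.L * mid_prob \<sigma> A \<delta> t + \<mu> / A * c * t + D"
    unfolding int_k by (simp add: algebra_simps)
  moreover have "mid_prob \<sigma> A \<delta> t = 1 - Qfun ((\<delta> + \<alpha> * A) / \<sigma>) - Qfun ((\<delta> + (1 - \<alpha>) * A) / \<sigma>)"
    by (simp add: mid_prob_def t_def algebra_simps)
  moreover have "\<mu> / A * c * t = \<mu> * \<alpha> * c" using assms by (simp add: t_def)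
  moreover have w: "X.w y = 1 / (sqrt (2 * pi) * \<sigma>) * exp (- y\<^sup>2 / (2 * \<sigma>\<^sup>2))" for y
    using assms by (simp add: normal_density_def real_sqrt_mult)
  moreover have "\<mu> / A * \<sigma>\<^sup>2 * (X.w \<delta> - X.w (A + \<delta>))
    = \<sigma> / A * \<mu> / sqrt (2 * pi) * (exp (- \<delta>\<^sup>2 / (2 * \<sigma>\<^sup>2)) - exp (- (A + \<delta>)\<^sup>2 / (2 * \<sigma>\<^sup>2)))"
  proof -
    have "\<mu> / A * \<sigma>\<^sup>2 * (X.w \<delta> - X.w (A + \<delta>)) = \<mu> / A * \<sigma>\<^sup>2 * (1 / (sqrt (2 * pi) * \<sigma>)) *
      (exp (- \<delta>\<^sup>2 / (2 * \<sigma>\<^sup>2)) - exp (- (A + \<delta>)\<^sup>2 / (2 * \<sigma>\<^sup>2)))"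
      unfolding w by (simp only: right_diff_distrib mult.assoc)
    also have "\<mu> / A * \<sigma>\<^sup>2 * (1 / (sqrt (2 * pi) * \<sigma>)) = \<sigma> / A * \<mu> / sqrt (2 * pi)"
      using assms by (simp add: power2_eq_square)
    finally show ?thesis .
  qed
  moreover have "\<delta> * X.w \<delta> = \<delta> / (sqrt (2 * pi) * \<sigma>) * exp (- \<delta>\<^sup>2 / (2 * \<sigma>\<^sup>2))"
    unfolding w by simp
  ultimately show ?thesis
    unfolding D_def c_def X.L_def X.E_def X.q_def by (simp only: mult.commute)
qed

section \<open>Entropy power inequality by transport\<close>

text \<open>An inequality, as g need not be onto. The substitution rule on compact intervals is
  extended by monotone convergence along [-n - 1, n + 1], which is nondegenerate already for n =
  0.\<close>

lemma nn_integral_increasing_substitution_le: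
  fixes f :: "real \<Rightarrow> ennreal" and g g' :: "real \<Rightarrow> real"
  assumes [measurable]: "f \<in> borel_measurable borel"
    and deriv: "\<And>x. (g has_real_derivative g' x) (at x)"
    and cont: "continuous_on UNIV g'" and nonneg: "\<And>x. 0 \<le> g' x"
  shows "(\<integral>\<^sup>+x. f (g x) * ennreal (g' x) \<partial>lborel) \<le> (\<integral>\<^sup>+y. f y \<partial>lborel)"
proof -
  have "continuous_on UNIV g"
    using deriv by (meson DERIV_isCont continuous_at_imp_continuous_on)
  then have [measurable]: "g \<in> borel_measurable borel" "g' \<in> borel_measurable borel"
    using cont by (simp_all add: borel_measurable_continuous_onI)
  let ?h = "\<lambda>x. f (g x) * ennreal (g' x)"
  have "(\<integral>\<^sup>+x. ?h x \<partial>lborel) \<le> (\<integral>\<^sup>+x. (SUP n::nat. ?h x * indicator {- real n - 1..real n + 1} x) \<partial>lborel)"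
  proof (rule nn_integral_mono)
    fix x :: real
    obtain n :: nat where "\<bar>x\<bar> \<le> real n" using real_arch_simple by blast
    then have "- real n - 1 \<le> x" "x \<le> real n + 1" by linarith+
    then have "?h x = ?h x * indicator {- real n - 1..real n + 1} x" by (simp add: indicator_def)
    also have "\<dots> \<le> (SUP n::nat. ?h x * indicator {- real n - 1..real n + 1} x)" by (rule SUP_upper) simp
    finally show "?h x \<le> (SUP n::nat. ?h x * indicator {- real n - 1..real n + 1} x)" .
  qed
  also have "\<dots> = (SUP n::nat. \<integral>\<^sup>+x. ?h x * indicator {- real n - 1..real n + 1} x \<partial>lborel)"
    by (rule nn_integral_monotone_convergence_SUP)
       (auto simp: incseq_def le_fun_def indicator_def)
  also have "\<dots> \<le> (\<integral>\<^sup>+y. f y \<partial>lborel)"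
  proof (rule SUP_least)
    fix n :: nat
    have "(\<integral>\<^sup>+x. ?h x * indicator {- real n - 1..real n + 1} x \<partial>lborel)
      = (\<integral>\<^sup>+y. f y * indicator {g (- real n - 1)..g (real n + 1)} y \<partial>lborel)"
      using deriv nonneg continuous_on_subset[OF cont]
      by (intro nn_integral_substitution_aux[symmetric]) auto
    also have "\<dots> \<le> (\<integral>\<^sup>+y. f y \<partial>lborel)"
      by (intro nn_integral_mono) (simp add: indicator_def)
    finally show "(\<integral>\<^sup>+x. ?h x * indicator {- real n - 1..real n + 1} x \<partial>lborel) \<le> (\<integral>\<^sup>+y. f y \<partial>lborel)" .
  qed
  finally show ?thesis .
qed

text \<open>Weighted AM-GM, as convexity of exp between ln a and ln b.\<close>

lemma weighted_exp_ln_le: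
  assumes "0 < a" "0 < b" "0 \<le> l" "l \<le> (1::real)"
  shows "exp (l * ln a + (1 - l) * ln b) \<le> l * a + (1 - l) * b"
  using convex_onD[OF exp_convex, of "1 - l" "ln a" "ln b"] assms by (simp add: algebra_simps)

locale gaussian_transport =
  fixes \<sigma> A :: real and T T' :: "real \<Rightarrow> real"
  assumes sigma_pos: "\<sigma> > 0"
    and deriv: "\<And>u. (T has_real_derivative T' u) (at u)"
    and cont: "continuous_on UNIV T'"
    and T'_pos: "\<And>u. 0 < T' u"
    and range: "\<And>u. 0 \<le> T u" "\<And>u. T u \<le> A"
    and ln_T'_integrable: "integrable (noise 1) (\<lambda>u. ln (T' u))"
begin

lemma T_measurable [measurable]: "T \<in> borel_measurable borel"
proof (rule borel_measurable_continuous_onI)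
  show "continuous_on UNIV T" using deriv by (meson DERIV_isCont continuous_at_imp_continuous_on)
qed

lemma T'_measurable [measurable]: "T' \<in> borel_measurable borel"
  using cont by (rule borel_measurable_continuous_onI)

definition input :: "real measure" where "input = distr (noise 1) borel T"

sublocale U: prob_space "noise 1" by (rule prob_space_noise) simp

sublocale C: bounded_input_channel \<sigma> A input
proof (rule bounded_input_channel.intro)
  show "prob_space input" unfolding input_def by (rule U.prob_space_distr) simp
  show "AE x in input. 0 \<le> x \<and> x \<le> A"
    unfolding input_def using range by (subst AE_distr_iff) simp_all
qed (simp_all add: sigma_pos input_def)

sublocale UZ: pair_prob_space "noise 1" "noise \<sigma>" ..

lemma input_pair_eq:
  "input \<Otimes>\<^sub>M noise \<sigma> = distr (noise 1 \<Otimes>\<^sub>M noise \<sigma>) (borel \<Otimes>\<^sub>M noise \<sigma>) (\<lambda>(u, z). (T u, z))"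
proof -
  have "distr (noise 1) borel T \<Otimes>\<^sub>M distr (noise \<sigma>) (noise \<sigma>) (\<lambda>z. z)
    = distr (noise 1 \<Otimes>\<^sub>M noise \<sigma>) (borel \<Otimes>\<^sub>M noise \<sigma>) (\<lambda>(u, z). (T u, z))"
    by (rule pair_measure_distr) (simp_all add: distr_id2 C.noise.sigma_finite_measure_axioms)
  then show ?thesis by (simp add: input_def distr_id2)
qed

lemma integrable_ln_out: "integrable (noise 1 \<Otimes>\<^sub>M noise \<sigma>) (\<lambda>p. ln (C.out_density (T (fst p) + snd p)))"
  and integral_ln_out: "(\<integral>p. ln (C.out_density (fst p + snd p)) \<partial>(input \<Otimes>\<^sub>M noise \<sigma>))
    = (\<integral>p. ln (C.out_density (T (fst p) + snd p)) \<partial>(noise 1 \<Otimes>\<^sub>M noise \<sigma>))"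
proof -
  have "integrable (distr (noise 1 \<Otimes>\<^sub>M noise \<sigma>) (borel \<Otimes>\<^sub>M noise \<sigma>) (\<lambda>(u, z). (T u, z)))
      (\<lambda>p. ln (C.out_density (fst p + snd p)))"
    using C.integrable_ln_out unfolding input_pair_eq .
  then show "integrable (noise 1 \<Otimes>\<^sub>M noise \<sigma>) (\<lambda>p. ln (C.out_density (T (fst p) + snd p)))"
    by (subst (asm) integrable_distr_eq) (simp_all add: case_prod_unfold)
  show "(\<integral>p. ln (C.out_density (fst p + snd p)) \<partial>(input \<Otimes>\<^sub>M noise \<sigma>))
    = (\<integral>p. ln (C.out_density (T (fst p) + snd p)) \<partial>(noise 1 \<Otimes>\<^sub>M noise \<sigma>))"
    unfolding input_pair_eq by (subst integral_distr) (simp_all add: case_prod_unfold)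
qed

lemma nn_integral_noise:
  "g \<in> borel_measurable borel \<Longrightarrow>
    (\<integral>\<^sup>+z. g z \<partial>noise \<tau>) = (\<integral>\<^sup>+z. ennreal (normal_density 0 \<tau> z) * g z \<partial>lborel)"
  unfolding noise_def by (subst nn_integral_density) simp_all

lemma out_mass: "(\<integral>\<^sup>+y. ennreal (C.out_density y) \<partial>lborel) = 1"
  using C.nn_integral_out[of "\<lambda>_. 1"] C.pair.emeasure_space_1 by simp

section \<open>Rotation of the Gaussian pair by a fixed angle\<close>

context
  fixes c s :: real
  assumes c_pos: "0 < c" and s_pos: "0 < s" and circle: "c\<^sup>2 + s\<^sup>2 = 1"
begin

text \<open>With v = z / \<sigma>, the product density of (u, v) is invariant under rotation.
  Dividing by the density of U1 leaves that of U2, and 1 / \<sigma> comes from the scaling of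
  z.\<close>

lemma rotated_density:
  "std_normal_density u * normal_density 0 \<sigma> z / std_normal_density (c * u + s * z / \<sigma>)
    = std_normal_density (- s * u + c * z / \<sigma>) / \<sigma>"
proof -
  let ?x = "c * u + s * z / \<sigma>" and ?y = "- s * u + c * z / \<sigma>"
  have "(c * u + s * v)\<^sup>2 + (- s * u + c * v)\<^sup>2 = (c\<^sup>2 + s\<^sup>2) * (u\<^sup>2 + v\<^sup>2)" for v by algebra
  from this[of "z / \<sigma>"] have "?x\<^sup>2 + ?y\<^sup>2 = (c\<^sup>2 + s\<^sup>2) * (u\<^sup>2 + (z / \<sigma>)\<^sup>2)" by simp
  then have "exp (- u\<^sup>2 / 2) * exp (- (z / \<sigma>)\<^sup>2 / 2) = exp (- ?x\<^sup>2 / 2) * exp (- ?y\<^sup>2 / 2)"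
    unfolding circle by (simp flip: exp_add)
  moreover have "normal_density 0 \<sigma> z = 1 / sqrt (2 * pi) * exp (- (z / \<sigma>)\<^sup>2 / 2) / \<sigma>"
    using sigma_pos by (simp add: normal_density_def real_sqrt_mult power_divide)
  ultimately have "std_normal_density u * normal_density 0 \<sigma> z = std_normal_density ?x * (std_normal_density ?y / \<sigma>)"
    by (simp add: std_normal_density_def mult.assoc)
  then show ?thesis using normal_density_pos[of 1 0 ?x] by simp
qed

text \<open>Here c T'(u) + \<sigma> s is the derivative of the output along U1 at fixed U2. Dividing
  by the density of U1 removes its weight, so for each U2 the substitution leaves at most the total
  mass 1 of the output density; averaging over U2 keeps this bound.\<close>

lemma rotated_mass:
  "(\<integral>\<^sup>+p. ennreal (C.out_density (T (fst p) + snd p) * (c * T' (fst p) + \<sigma> * s)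
      / std_normal_density (c * fst p + s * snd p / \<sigma>)) \<partial>(noise 1 \<Otimes>\<^sub>M noise \<sigma>)) \<le> 1"
proof -
  let ?f = C.out_density and ?\<phi> = std_normal_density
  have nn: "0 \<le> ?f y" "0 \<le> c * T' u + \<sigma> * s" for y u
    using C.out_density_pos[of y] T'_pos[of u] c_pos s_pos sigma_pos by (simp_all add: less_imp_le)
  have "(\<integral>\<^sup>+p. ennreal (?f (T (fst p) + snd p) * (c * T' (fst p) + \<sigma> * s)
      / ?\<phi> (c * fst p + s * snd p / \<sigma>)) \<partial>(noise 1 \<Otimes>\<^sub>M noise \<sigma>))
    = (\<integral>\<^sup>+u. \<integral>\<^sup>+z. ennreal (?f (T u + z) * (c * T' u + \<sigma> * s) / ?\<phi> (c * u + s * z / \<sigma>)) \<partial>noise \<sigma> \<partial>noise 1)"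
    by (subst C.noise.nn_integral_fst[symmetric]) simp_all
  also have "\<dots> = (\<integral>\<^sup>+u. ennreal (?\<phi> u) * (\<integral>\<^sup>+z. ennreal (normal_density 0 \<sigma> z) *
      ennreal (?f (T u + z) * (c * T' u + \<sigma> * s) / ?\<phi> (c * u + s * z / \<sigma>)) \<partial>lborel) \<partial>lborel)"
    by (simp add: nn_integral_noise)
  also have "\<dots> = (\<integral>\<^sup>+u. \<integral>\<^sup>+z. ennreal (?f (T u + z) * (c * T' u + \<sigma> * s)
      * ?\<phi> (- s * u + c * z / \<sigma>) / \<sigma>) \<partial>lborel \<partial>lborel)"
  proof (rule nn_integral_cong)
    fix u :: real
    have "ennreal (?\<phi> u) * (\<integral>\<^sup>+z. ennreal (normal_density 0 \<sigma> z) *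
        ennreal (?f (T u + z) * (c * T' u + \<sigma> * s) / ?\<phi> (c * u + s * z / \<sigma>)) \<partial>lborel)
      = (\<integral>\<^sup>+z. ennreal (?\<phi> u) * (ennreal (normal_density 0 \<sigma> z) *
        ennreal (?f (T u + z) * (c * T' u + \<sigma> * s) / ?\<phi> (c * u + s * z / \<sigma>))) \<partial>lborel)"
      by (rule nn_integral_cmult[symmetric]) measurable
    also have "\<dots> = (\<integral>\<^sup>+z. ennreal (?f (T u + z) * (c * T' u + \<sigma> * s) * ?\<phi> (- s * u + c * z / \<sigma>) / \<sigma>) \<partial>lborel)"
    proof (rule nn_integral_cong)
      fix z :: real
      have "?\<phi> u * (normal_density 0 \<sigma> z * (?f (T u + z) * (c * T' u + \<sigma> * s) / ?\<phi> (c * u + s * z / \<sigma>)))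
        = ?f (T u + z) * (c * T' u + \<sigma> * s) * (?\<phi> u * normal_density 0 \<sigma> z / ?\<phi> (c * u + s * z / \<sigma>))"
        by (simp only: times_divide_eq_right times_divide_eq_left mult_ac)
      also have "\<dots> = ?f (T u + z) * (c * T' u + \<sigma> * s) * ?\<phi> (- s * u + c * z / \<sigma>) / \<sigma>"
        unfolding rotated_density by simp
      finally show "ennreal (?\<phi> u) * (ennreal (normal_density 0 \<sigma> z) *
          ennreal (?f (T u + z) * (c * T' u + \<sigma> * s) / ?\<phi> (c * u + s * z / \<sigma>)))
        = ennreal (?f (T u + z) * (c * T' u + \<sigma> * s) * ?\<phi> (- s * u + c * z / \<sigma>) / \<sigma>)"
        by (simp only: ennreal_mult'[symmetric] normal_density_nonneg)
    qed
    finally show "ennreal (?\<phi> u) * (\<integral>\<^sup>+z. ennreal (normal_density 0 \<sigma> z) *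
        ennreal (?f (T u + z) * (c * T' u + \<sigma> * s) / ?\<phi> (c * u + s * z / \<sigma>)) \<partial>lborel)
      = (\<integral>\<^sup>+z. ennreal (?f (T u + z) * (c * T' u + \<sigma> * s) * ?\<phi> (- s * u + c * z / \<sigma>) / \<sigma>) \<partial>lborel)" .
  qed
  \<comment> \<open>At fixed u the new variable is the value y = - s u + c z / \<sigma> of U2. The
    Jacobian \<sigma> / c cancels 1 / \<sigma> and leaves T'(u) + \<sigma> s / c, the derivative in
    u of the output at fixed y.\<close>
  also have "\<dots> = (\<integral>\<^sup>+u. \<integral>\<^sup>+y. ennreal (?\<phi> y) * (ennreal (?f (T u + \<sigma> * (y + s * u) / c))
      * ennreal (T' u + \<sigma> * s / c)) \<partial>lborel \<partial>lborel)"
  proof (rule nn_integral_cong)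
    fix u :: real
    let ?g = "\<lambda>z. ennreal (?f (T u + z) * (c * T' u + \<sigma> * s) * ?\<phi> (- s * u + c * z / \<sigma>) / \<sigma>)"
    have "(\<integral>\<^sup>+z. ?g z \<partial>lborel) = ennreal \<bar>\<sigma> / c\<bar> * (\<integral>\<^sup>+y. ?g (\<sigma> * s * u / c + \<sigma> / c * y) \<partial>lborel)"
      using sigma_pos c_pos by (intro nn_integral_real_affine) simp_all
    also have "\<dots> = (\<integral>\<^sup>+y. ennreal \<bar>\<sigma> / c\<bar> * ?g (\<sigma> * s * u / c + \<sigma> / c * y) \<partial>lborel)"
      by (rule nn_integral_cmult[symmetric]) measurable
    also have "\<dots> = (\<integral>\<^sup>+y. ennreal (?\<phi> y) * (ennreal (?f (T u + \<sigma> * (y + s * u) / c))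
      * ennreal (T' u + \<sigma> * s / c)) \<partial>lborel)"
    proof (rule nn_integral_cong)
      fix y :: real
      have p: "0 \<le> \<sigma> / c" using sigma_pos c_pos by simp
      have 1: "\<sigma> * s * u / c + \<sigma> / c * y = \<sigma> * (y + s * u) / c"
        by (simp add: distrib_left add_divide_distrib)
      have 2: "- s * u + c * (\<sigma> * (y + s * u) / c) / \<sigma> = y"
        using sigma_pos c_pos by simp
      have "\<sigma> / c * (?f (T u + \<sigma> * (y + s * u) / c) * (c * T' u + \<sigma> * s) * ?\<phi> y / \<sigma>)
        = ?\<phi> y * (?f (T u + \<sigma> * (y + s * u) / c) * (T' u + \<sigma> * s / c))"
        using sigma_pos c_pos by (simp add: field_simps)
      then show "ennreal \<bar>\<sigma> / c\<bar> * ?g (\<sigma> * s * u / c + \<sigma> / c * y)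
        = ennreal (?\<phi> y) * (ennreal (?f (T u + \<sigma> * (y + s * u) / c)) * ennreal (T' u + \<sigma> * s / c))"
        unfolding 1 2 abs_of_nonneg[OF p]
        by (simp only: ennreal_mult'[symmetric] normal_density_nonneg nn p)
    qed
    finally show "(\<integral>\<^sup>+z. ?g z \<partial>lborel) = (\<integral>\<^sup>+y. ennreal (?\<phi> y) * (ennreal (?f (T u + \<sigma> * (y + s * u) / c))
      * ennreal (T' u + \<sigma> * s / c)) \<partial>lborel)" .
  qed
  \<comment> \<open>The inner integral now runs along a line of constant U2 = y. There U1 = (u + s
    y) / c, so u parametrizes the line as well as U1 does.\<close>
  also have "\<dots> = (\<integral>\<^sup>+y. \<integral>\<^sup>+u. ennreal (?\<phi> y) * (ennreal (?f (T u + \<sigma> * (y + s * u) / c))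
      * ennreal (T' u + \<sigma> * s / c)) \<partial>lborel \<partial>lborel)"
    by (rule lborel_pair.Fubini') measurable
  also have "\<dots> \<le> (\<integral>\<^sup>+y. ennreal (?\<phi> y) \<partial>lborel)"
  proof (rule nn_integral_mono)
    fix y :: real
    let ?\<Psi> = "\<lambda>u. T u + \<sigma> * (y + s * u) / c"
    have "(\<integral>\<^sup>+u. ennreal (?f (?\<Psi> u)) * ennreal (T' u + \<sigma> * s / c) \<partial>lborel) \<le> (\<integral>\<^sup>+y. ennreal (?f y) \<partial>lborel)"
    proof (rule nn_integral_increasing_substitution_le)
      show "(?\<Psi> has_real_derivative T' u + \<sigma> * s / c) (at u)" for u
        using c_pos by (auto intro!: derivative_eq_intros deriv)
      show "continuous_on UNIV (\<lambda>u. T' u + \<sigma> * s / c)" by (intro continuous_intros cont)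
      show "0 \<le> T' u + \<sigma> * s / c" for u
        using T'_pos[of u] c_pos s_pos sigma_pos by (simp add: less_imp_le add_nonneg_nonneg)
    qed measurable
    then have "ennreal (?\<phi> y) * (\<integral>\<^sup>+u. ennreal (?f (?\<Psi> u)) * ennreal (T' u + \<sigma> * s / c) \<partial>lborel)
      \<le> ennreal (?\<phi> y) * 1"
      unfolding out_mass by (intro mult_left_mono) simp_all
    then show "(\<integral>\<^sup>+u. ennreal (?\<phi> y) * (ennreal (?f (?\<Psi> u)) * ennreal (T' u + \<sigma> * s / c)) \<partial>lborel)
      \<le> ennreal (?\<phi> y)"
      by (subst nn_integral_cmult) simp_all
  qed
  also have "\<dots> = 1" by (subst nn_integral_eq_integral) simp_all
  finally show ?thesis .
qed

lemma integrable_rotated: "integrable (noise 1 \<Otimes>\<^sub>M noise \<sigma>) (\<lambda>p. (c * fst p + s * snd p / \<sigma>)\<^sup>2)"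
  and integral_rotated: "(\<integral>p. (c * fst p + s * snd p / \<sigma>)\<^sup>2 \<partial>(noise 1 \<Otimes>\<^sub>M noise \<sigma>)) = 1"
proof -
  show int: "integrable (noise 1 \<Otimes>\<^sub>M noise \<sigma>) (\<lambda>p. (c * fst p + s * snd p / \<sigma>)\<^sup>2)"
  proof (rule Bochner_Integration.integrable_bound)
    show "integrable (noise 1 \<Otimes>\<^sub>M noise \<sigma>) (\<lambda>p. 2 * c\<^sup>2 * (fst p)\<^sup>2 + 2 * (s / \<sigma>)\<^sup>2 * (snd p)\<^sup>2)"
      by (intro Bochner_Integration.integrable_add integrable_mult_right
          UZ.integrable_pair_fst UZ.integrable_pair_snd noise_integrable_square sigma_pos) simp
    show "AE p in noise 1 \<Otimes>\<^sub>M noise \<sigma>. norm ((c * fst p + s * snd p / \<sigma>)\<^sup>2)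
        \<le> norm (2 * c\<^sup>2 * (fst p)\<^sup>2 + 2 * (s / \<sigma>)\<^sup>2 * (snd p)\<^sup>2)"
    proof (rule AE_I2)
      fix p :: "real \<times> real"
      have "(c * fst p + s * snd p / \<sigma>)\<^sup>2 \<le> 2 * (c * fst p)\<^sup>2 + 2 * (s * snd p / \<sigma>)\<^sup>2"
        by (rule power2_add_le)
      then show "norm ((c * fst p + s * snd p / \<sigma>)\<^sup>2)
          \<le> norm (2 * c\<^sup>2 * (fst p)\<^sup>2 + 2 * (s / \<sigma>)\<^sup>2 * (snd p)\<^sup>2)"
        by (simp add: power_mult_distrib power_divide)
    qed
  qed measurable
  have "(\<integral>p. (c * fst p + s * snd p / \<sigma>)\<^sup>2 \<partial>(noise 1 \<Otimes>\<^sub>M noise \<sigma>))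
    = (\<integral>u. (\<integral>z. (c * u + s * z / \<sigma>)\<^sup>2 \<partial>noise \<sigma>) \<partial>noise 1)"
    using UZ.integral_fst'[OF int] by simp
  also have "\<dots> = (\<integral>u. s\<^sup>2 + c\<^sup>2 * u\<^sup>2 \<partial>noise 1)"
  proof (rule Bochner_Integration.integral_cong[OF refl])
    fix u
    have "(\<integral>z. (c * u + s * z / \<sigma>)\<^sup>2 \<partial>noise \<sigma>)
      = (\<integral>z. c\<^sup>2 * u\<^sup>2 + 2 * c * u * s / \<sigma> * z + (s / \<sigma>)\<^sup>2 * z\<^sup>2 \<partial>noise \<sigma>)"
      by (intro Bochner_Integration.integral_cong) (simp_all add: power2_eq_square algebra_simps)
    also have "\<dots> = c\<^sup>2 * u\<^sup>2 + (s / \<sigma>)\<^sup>2 * \<sigma>\<^sup>2"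
      using noise_integrable_ident[OF sigma_pos] noise_integrable_square[OF sigma_pos]
        noise_mean[OF sigma_pos] noise_second_moment[OF sigma_pos] by simp
    finally show "(\<integral>z. (c * u + s * z / \<sigma>)\<^sup>2 \<partial>noise \<sigma>) = s\<^sup>2 + c\<^sup>2 * u\<^sup>2"
      using sigma_pos by (simp add: power_divide)
  qed
  also have "\<dots> = 1"
    using noise_integrable_square[of 1] noise_second_moment[of 1] circle U.prob_space
    by simp
  finally show "(\<integral>p. (c * fst p + s * snd p / \<sigma>)\<^sup>2 \<partial>(noise 1 \<Otimes>\<^sub>M noise \<sigma>)) = 1" .
qed

text \<open>Jensen for the ratio of f(Y) exp (h(U)) to the density of U1. Since U1 is again standard
  Gaussian, its expected log-density is minus the standard Gaussian entropy, and only E ln T'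
  remains of the transport map.\<close>

lemma integral_ln_out_le:
  "(\<integral>p. ln (C.out_density (T (fst p) + snd p)) \<partial>(noise 1 \<Otimes>\<^sub>M noise \<sigma>))
    \<le> - ln (2 * pi) / 2 - 1 / 2
      - (c\<^sup>2 * ((\<integral>u. ln (T' u) \<partial>noise 1) - ln c) + s\<^sup>2 * (ln \<sigma> - ln s))"
proof -
  let ?M = "noise 1 \<Otimes>\<^sub>M noise \<sigma>"
  let ?f = "\<lambda>p. C.out_density (T (fst p) + snd p)"
  let ?x = "\<lambda>p. c * fst p + s * snd p / \<sigma>"
  \<comment> \<open>A lower bound for ln (c T'(u) + \<sigma> s), linear in ln T'(u): weighted AM-GM
    for T'(u) / c and \<sigma> / s with weights c^2 and s^2. The divisions by c and s make the
    arithmetic mean equal to c T'(u) + \<sigma> s.\<close>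
  define h where "h u = c\<^sup>2 * (ln (T' u) - ln c) + s\<^sup>2 * (ln \<sigma> - ln s)" for u
  have [measurable]: "h \<in> borel_measurable borel" unfolding h_def[abs_def] by measurable
  define R where "R p = ?f p * exp (h (fst p)) / std_normal_density (?x p)" for p
  have exp_h: "exp (h u) \<le> c * T' u + \<sigma> * s" for u
  proof -
    have "s\<^sup>2 = 1 - c\<^sup>2" using circle by simp
    then have "h u = c\<^sup>2 * ln (T' u / c) + (1 - c\<^sup>2) * ln (\<sigma> / s)"
      using T'_pos[of u] c_pos s_pos sigma_pos by (simp add: h_def ln_divide_pos)
    moreover have "c\<^sup>2 \<le> 1" using circle zero_le_power2[of s] by linarith
    ultimately have "exp (h u) \<le> c\<^sup>2 * (T' u / c) + (1 - c\<^sup>2) * (\<sigma> / s)"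
      using weighted_exp_ln_le[of "T' u / c" "\<sigma> / s" "c\<^sup>2"] T'_pos[of u] c_pos s_pos sigma_pos by simp
    also have "\<dots> = c * T' u + \<sigma> * s"
      unfolding \<open>s\<^sup>2 = 1 - c\<^sup>2\<close>[symmetric] using c_pos s_pos by (simp add: power2_eq_square)
    finally show ?thesis .
  qed
  have R_pos: "0 < R p" for p
    using C.out_density_pos normal_density_pos[of 1 0] by (simp add: R_def)
  have ln_R: "ln (R p) = ln (?f p) + h (fst p) + (ln (2 * pi) / 2 + 1 / 2 * (?x p)\<^sup>2)" for p
  proof -
    have "ln (R p) = ln (?f p) + h (fst p) - ln (std_normal_density (?x p))"
      using C.out_density_pos normal_density_pos[of 1 0 "?x p"]
      by (simp add: R_def ln_divide_pos ln_mult_pos)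
    then show ?thesis by (simp add: ln_normal_density)
  qed
  have int_h: "integrable (noise 1) h"
    unfolding h_def[abs_def] using ln_T'_integrable
    by (intro Bochner_Integration.integrable_add integrable_mult_right Bochner_Integration.integrable_diff
        U.integrable_const)
  have int_x: "integrable ?M (\<lambda>p. ln (2 * pi) / 2 + 1 / 2 * (?x p)\<^sup>2)"
    by (intro Bochner_Integration.integrable_add integrable_mult_right integrable_rotated UZ.integrable_const)
  have int_fh: "integrable ?M (\<lambda>p. ln (?f p) + h (fst p))"
    by (intro Bochner_Integration.integrable_add integrable_ln_out UZ.integrable_pair_fst int_h)
  have "(\<integral>p. ln (R p) \<partial>?M) \<le> 0"
  proof (rule UZ.expectation_ln_le)
    show "R \<in> borel_measurable ?M" unfolding R_def[abs_def] by measurable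
    have "(\<integral>\<^sup>+p. ennreal (R p) \<partial>?M) \<le> (\<integral>\<^sup>+p. ennreal (?f p * (c * T' (fst p) + \<sigma> * s)
      / std_normal_density (?x p)) \<partial>?M)"
      unfolding R_def using exp_h C.out_density_pos
      by (intro nn_integral_mono ennreal_leI divide_right_mono mult_left_mono) (simp_all add: less_imp_le)
    also have "\<dots> \<le> 1" by (rule rotated_mass)
    finally show "(\<integral>\<^sup>+p. ennreal (R p) \<partial>?M) \<le> 1" .
    show "integrable ?M (\<lambda>p. ln (R p))"
      unfolding ln_R by (intro Bochner_Integration.integrable_add[OF int_fh int_x])
  qed (rule R_pos)
  moreover have "(\<integral>p. ln (R p) \<partial>?M) = (\<integral>p. ln (?f p) + h (fst p) \<partial>?M)
      + (\<integral>p. ln (2 * pi) / 2 + 1 / 2 * (?x p)\<^sup>2 \<partial>?M)"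
    unfolding ln_R by (rule Bochner_Integration.integral_add[OF int_fh int_x])
  moreover have "(\<integral>p. ln (?f p) + h (fst p) \<partial>?M) = (\<integral>p. ln (?f p) \<partial>?M) + (\<integral>p. h (fst p) \<partial>?M)"
    by (intro Bochner_Integration.integral_add integrable_ln_out UZ.integrable_pair_fst int_h)
  moreover have "(\<integral>p. h (fst p) \<partial>?M) = (\<integral>u. h u \<partial>noise 1)"
    using UZ.integral_fst'[OF UZ.integrable_pair_fst[OF int_h]] by simp
  moreover have "(\<integral>u. h u \<partial>noise 1) = c\<^sup>2 * ((\<integral>u. ln (T' u) \<partial>noise 1) - ln c) + s\<^sup>2 * (ln \<sigma> - ln s)"
    unfolding h_def using ln_T'_integrable U.prob_space by simp
  moreover have "(\<integral>p. ln (2 * pi) / 2 + 1 / 2 * (?x p)\<^sup>2 \<partial>?M) = ln (2 * pi) / 2 + 1 / 2"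
  proof -
    have "(\<integral>p. ln (2 * pi) / 2 + 1 / 2 * (?x p)\<^sup>2 \<partial>?M)
      = (\<integral>p. ln (2 * pi) / 2 \<partial>?M) + (\<integral>p. 1 / 2 * (?x p)\<^sup>2 \<partial>?M)"
      by (intro Bochner_Integration.integral_add integrable_mult_right integrable_rotated UZ.integrable_const)
    then show ?thesis using integral_rotated UZ.prob_space by simp
  qed
  ultimately show ?thesis by linarith
qed

end

text \<open>As h(T(U)) = h(U) + E ln T'(U), the number exp (2 E ln T') is the entropy power of the
  input, and \<sigma>^2 is that of the noise. Adding them bounds the entropy power of the output
  from below.\<close>

theorem chan_MI_entropy_power:
  "1/2 * ln (1 + exp (2 * (\<integral>u. ln (T' u) \<partial>noise 1)) / \<sigma>\<^sup>2) \<le> chan_MI \<sigma> input"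
proof -
  define h where "h = (\<integral>u. ln (T' u) \<partial>noise 1)"
  define \<rho> where "\<rho> = exp (2 * h) / \<sigma>\<^sup>2"
  have rho: "0 < \<rho>" using sigma_pos by (simp add: \<rho>_def)
  \<comment> \<open>The optimal angle: c^2 and s^2 are the shares of the two entropy powers in their
    sum. Then h - ln c and ln \<sigma> - ln s coincide, and their weighted average
    collapses.\<close>
  define c where "c = sqrt (\<rho> / (1 + \<rho>))"
  define s where "s = sqrt (1 / (1 + \<rho>))"
  have cs: "0 < c" "0 < s" using rho by (simp_all add: c_def s_def)
  have sq: "c\<^sup>2 = \<rho> / (1 + \<rho>)" "s\<^sup>2 = 1 / (1 + \<rho>)" using rho by (simp_all add: c_def s_def)
  have circle: "c\<^sup>2 + s\<^sup>2 = 1" unfolding sq using rho by (simp add: field_simps)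
  have ln_c: "ln c = (ln \<rho> - ln (1 + \<rho>)) / 2" and ln_s: "ln s = - ln (1 + \<rho>) / 2"
    unfolding c_def s_def using rho by (simp_all add: ln_sqrt ln_divide_pos)
  have ln_rho: "ln \<rho> = 2 * h - 2 * ln \<sigma>"
    unfolding \<rho>_def using sigma_pos by (simp add: ln_divide_pos ln_realpow)
  have ln_s2: "ln (2 * pi * \<sigma>\<^sup>2) = ln (2 * pi) + 2 * ln \<sigma>"
    using sigma_pos by (subst ln_mult_pos) (simp_all add: ln_realpow)
  define X where "X = c\<^sup>2 * (h - ln c) + s\<^sup>2 * (ln \<sigma> - ln s)"
  define I where "I = (\<integral>p. ln (C.out_density (T (fst p) + snd p)) \<partial>(noise 1 \<Otimes>\<^sub>M noise \<sigma>))"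
  have "chan_MI \<sigma> input = - ln (2 * pi * \<sigma>\<^sup>2) / 2 - 1 / 2
    - (\<integral>p. ln (C.out_density (T (fst p) + snd p)) \<partial>(noise 1 \<Otimes>\<^sub>M noise \<sigma>))"
    unfolding C.chan_MI_eq C.integral_ln_noise integral_ln_out ..
  then have "chan_MI \<sigma> input = - (ln (2 * pi) + 2 * ln \<sigma>) / 2 - 1 / 2 - I"
    unfolding ln_s2 I_def .
  moreover have "I \<le> - ln (2 * pi) / 2 - 1 / 2 - X"
    using integral_ln_out_le[OF cs circle] unfolding I_def X_def h_def .
  ultimately have "- ln \<sigma> + X \<le> chan_MI \<sigma> input"
    by (simp add: field_simps)
  moreover have "- ln \<sigma> + X = 1/2 * ln (1 + \<rho>)"
  proof -
    have "h - ln c = ln \<sigma> + ln (1 + \<rho>) / 2" "ln \<sigma> - ln s = ln \<sigma> + ln (1 + \<rho>) / 2"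
      unfolding ln_c ln_s ln_rho by (simp_all add: field_simps)
    then have "- ln \<sigma> + X = - ln \<sigma> + (c\<^sup>2 + s\<^sup>2) * (ln \<sigma> + ln (1 + \<rho>) / 2)" by (simp only: X_def distrib_right)
    then show ?thesis unfolding circle by simp
  qed
  ultimately show ?thesis by (simp add: \<rho>_def h_def)
qed

end

section \<open>The truncated exponential input\<close>

locale truncated_exponential =
  fixes \<sigma> A \<mu> :: real
  assumes sigma_pos: "\<sigma> > 0" and A_pos: "A > 0" and mu_pos: "\<mu> > 0"
begin

definition q :: real where "q = 1 - exp (- \<mu>)"

text \<open>With \<Phi>(u) = \<open>Qfun (- u)\<close> the standard Gaussian distribution function,
  this is 1 - q \<Phi>(u), the value of exp (- \<mu> x / A) at the quantile x of level
  \<Phi>(u).\<close>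

definition B :: "real \<Rightarrow> real" where "B u = 1 - q * Qfun (- u)"

text \<open>The truncated exponential law on [0, A] has distribution function (1 - exp (- \<mu> x /
  A)) / q; this map returns the x at which it equals \<Phi>(u).\<close>

definition T :: "real \<Rightarrow> real" where "T u = - (A / \<mu>) * ln (B u)"

definition T' :: "real \<Rightarrow> real" where "T' u = A * q / \<mu> * std_normal_density u / B u"

lemma q_bounds: "0 < q" "q < 1"
  using mu_pos by (simp_all add: q_def)

lemma B_bounds: "exp (- \<mu>) < B u" "B u < 1" "0 < B u"
proof -
  have "q * Qfun (- u) < q" using q_bounds Qfun_less_1[of "-u"] by simp
  then show 1: "exp (- \<mu>) < B u" by (simp add: B_def q_def)
  show "B u < 1" using q_bounds Qfun_pos[of "-u"] by (simp add: B_def)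
  show "0 < B u" by (rule less_trans[OF exp_gt_zero 1])
qed

lemma T_bounds: "0 \<le> T u" "T u \<le> A"
proof -
  have ln_B: "ln (B u) < 0" "- \<mu> < ln (B u)"
    using B_bounds[of u] ln_less_cancel_iff[of "exp (- \<mu>)" "B u"] by simp_all
  then show "0 \<le> T u" using A_pos mu_pos by (simp add: T_def divide_nonpos_pos mult_nonneg_nonpos)
  have "T u = A / \<mu> * (- ln (B u))" by (simp add: T_def)
  also have "\<dots> \<le> A / \<mu> * \<mu>" using ln_B A_pos mu_pos by (intro mult_left_mono) simp_all
  finally show "T u \<le> A" using mu_pos by simp
qed

lemma DERIV_Qfun_uminus: "((\<lambda>u. Qfun (- u)) has_real_derivative std_normal_density u) (at u)"
proof -
  have "((\<lambda>u. Qfun (- u)) has_real_derivative - std_normal_density (- u) * (- 1)) (at u)"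
    by (rule DERIV_chain2[OF Qfun_has_derivative]) (auto intro!: derivative_eq_intros)
  then show ?thesis by (simp add: normal_density_def)
qed

lemma DERIV_T: "(T has_real_derivative T' u) (at u)"
  unfolding T_def[abs_def] T'_def B_def
  using B_bounds(3)[of u, unfolded B_def] mu_pos
  by (auto intro!: derivative_eq_intros DERIV_Qfun_uminus simp: field_simps)

lemma continuous_B: "continuous_on UNIV B"
proof (intro continuous_at_imp_continuous_on ballI)
  fix u
  show "isCont B u"
    unfolding B_def[abs_def] using DERIV_isCont[OF DERIV_Qfun_uminus[of u]] by (intro continuous_intros)
qed

lemma continuous_T': "continuous_on UNIV T'"
  unfolding T'_def[abs_def] std_normal_density_def using B_bounds(3) mu_pos
  by (intro continuous_intros continuous_B) (auto simp: less_imp_neq[symmetric])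

lemma T'_pos: "0 < T' u"
  using A_pos mu_pos q_bounds B_bounds(3)[of u] normal_density_pos[of 1 0 u] by (simp add: T'_def)

lemma T_measurable [measurable]: "T \<in> borel_measurable borel"
proof (rule borel_measurable_continuous_onI)
  show "continuous_on UNIV T" using DERIV_T by (meson DERIV_isCont continuous_at_imp_continuous_on)
qed

text \<open>The log-density of the input is affine and that of U quadratic, so E ln T' reduces to
  the mean of the input and the second moment of U.\<close>

lemma ln_T': "ln (T' u) = (ln (A * q / \<mu>) - ln (2 * pi) / 2) + \<mu> / A * T u - 1 / 2 * u\<^sup>2"
proof -
  have "ln (T' u) = ln (A * q / \<mu>) + ln (std_normal_density u) - ln (B u)"
    using A_pos mu_pos q_bounds B_bounds(3)[of u] normal_density_pos[of 1 0 u]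
    by (simp add: T'_def ln_divide_pos ln_mult_pos)
  moreover have "\<mu> / A * T u = - ln (B u)" using A_pos mu_pos by (simp add: T_def)
  ultimately show ?thesis by (simp add: ln_normal_density)
qed

lemma T_integrable: "integrable (noise 1) T"
proof -
  interpret prob_space "noise 1" by (rule prob_space_noise) simp
  show ?thesis by (rule integrable_const_bound[of _ A]) (use T_bounds in simp_all)
qed

text \<open>The substitution t = \<Phi>(u) turns the mean into an integral of the quantile function
  over (0, 1). It is carried out as the fundamental theorem on the whole line, with the limits of Q
  as boundary values.\<close>

lemma T_mean: "(\<integral>u. T u \<partial>noise 1) = (1 / \<mu> - exp (- \<mu>) / q) * A"
proof -
  \<comment> \<open>An antiderivative in t of - (A / \<mu>) ln (1 - q t), the quantile function at
    level t.\<close>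
  define K where "K t = A / (\<mu> * q) * ((1 - q * t) * ln (1 - q * t) - (1 - q * t))" for t
  have K: "((\<lambda>u. K (Qfun (- u))) has_real_derivative T u * std_normal_density u) (at u)" for u
  proof -
    define b where "b = B u"
    have b: "0 < b" "1 - q * Qfun (- u) = b" using B_bounds(3)[of u] by (simp_all add: b_def B_def)
    have "((\<lambda>t. (1 - q * t) * ln (1 - q * t) - (1 - q * t)) has_real_derivative - q * ln b) (at (Qfun (- u)))"
      using b by (auto intro!: derivative_eq_intros)
    then have "(K has_real_derivative A / (\<mu> * q) * (- q * ln b)) (at (Qfun (- u)))"
      unfolding K_def[abs_def] by (rule DERIV_cmult)
    from DERIV_chain2[OF this DERIV_Qfun_uminus] show ?thesis
      using q_bounds by (simp add: T_def b_def)
  qed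
  \<comment> \<open>Needed at t = 0 and t = 1. At t = 1 it uses q < 1: truncation keeps the quantile
    function bounded.\<close>
  have isCont_K: "isCont K t" if "q * t < 1" for t
    unfolding K_def[abs_def] using that by (intro continuous_intros) simp_all
  have top: "((\<lambda>u. K (Qfun (- u))) \<longlongrightarrow> K 1) at_top"
    using q_bounds
    by (intro isCont_tendsto_compose[OF isCont_K] filterlim_compose[OF Qfun_tendsto_at_bot]
        filterlim_uminus_at_bot_at_top) simp
  have bot: "((\<lambda>u. K (Qfun (- u))) \<longlongrightarrow> K 0) at_bot"
    by (intro isCont_tendsto_compose[OF isCont_K] filterlim_compose[OF Qfun_tendsto_at_top]
        filterlim_uminus_at_top_at_bot) simp
  have "(LBINT u=-\<infinity>..\<infinity>. T u * std_normal_density u) = K 1 - K 0"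
  proof (rule interval_integral_FTC_nonneg(2))
    show "isCont (\<lambda>u. T u * std_normal_density u) u" for u
      using DERIV_isCont[OF DERIV_T[of u]] DERIV_isCont[OF DERIV_normal_density[of 1 u]]
      by (intro continuous_intros) simp_all
    show "AE u in lborel. -\<infinity> < ereal u \<longrightarrow> ereal u < \<infinity> \<longrightarrow> 0 \<le> T u * std_normal_density u"
      using T_bounds by simp
  qed (use K top bot in \<open>simp_all add: ereal_tendsto_simps\<close>)
  moreover have "(LBINT u=-\<infinity>..\<infinity>. T u * std_normal_density u) = (\<integral>u. T u \<partial>noise 1)"
    by (simp add: interval_lebesgue_integral_def set_lebesgue_integral_def noise_integral mult.commute)
  moreover have "K 1 - K 0 = A / (\<mu> * q) * (q - \<mu> * exp (- \<mu>))"
  proof -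
    have "a * (x * - \<mu> - x) - a * ((1 - 0) * 0 - (1 - 0)) = a * ((1 - x) - \<mu> * x)" for a x
      by (simp add: algebra_simps)
    moreover have "1 - q * 1 = exp (- \<mu>)" by (simp add: q_def)
    ultimately show ?thesis unfolding K_def by (simp only: ln_exp mult_zero_right diff_zero ln_one q_def)
  qed
  moreover have "A / (\<mu> * q) * (q - \<mu> * exp (- \<mu>)) = (1 / \<mu> - exp (- \<mu>) / q) * A"
    using mu_pos q_bounds by (simp add: field_simps)
  ultimately show ?thesis by simp
qed

lemma ln_T'_integrable: "integrable (noise 1) (\<lambda>u. ln (T' u))"
proof -
  interpret prob_space "noise 1" by (rule prob_space_noise) simp
  show ?thesis unfolding ln_T'
    by (intro Bochner_Integration.integrable_add Bochner_Integration.integrable_diff integrable_mult_right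
        T_integrable noise_integrable_square integrable_const) simp
qed

lemma ln_T'_mean: "(\<integral>u. ln (T' u) \<partial>noise 1)
  = ln (A * q / \<mu>) - ln (2 * pi) / 2 + \<mu> * (1 / \<mu> - exp (- \<mu>) / q) - 1 / 2"
proof -
  interpret prob_space "noise 1" by (rule prob_space_noise) simp
  have "(\<integral>u. ln (T' u) \<partial>noise 1)
    = (ln (A * q / \<mu>) - ln (2 * pi) / 2) + \<mu> / A * (\<integral>u. T u \<partial>noise 1) - 1 / 2 * (\<integral>u. u\<^sup>2 \<partial>noise 1)"
    unfolding ln_T' using T_integrable noise_integrable_square[of 1] prob_space by simp
  then show ?thesis
    unfolding T_mean using noise_second_moment[of 1] A_pos by simp
qed

sublocale gaussian_transport \<sigma> A T T'
  by (rule gaussian_transport.intro[OF sigma_pos DERIV_T continuous_T' T'_pos T_bounds ln_T'_integrable])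

lemma input_admissible: "admissible_input A ((1 / \<mu> - exp (- \<mu>) / q) * A) input"
  unfolding admissible_input_def
proof (intro conjI)
  show "prob_space input" by (rule C.input.prob_space_axioms)
  show "AE x in input. 0 \<le> x" using C.input_range by eventually_elim simp
  have "T -` {x. A < x} = {}" using T_bounds(2) by (auto simp: not_less)
  then show "measure input {x. A < x} = 0" unfolding input_def by (subst measure_distr) simp_all
  show "integrable input (\<lambda>x. x)" unfolding input_def using T_integrable by (subst integrable_distr_eq) simp_all
  show "(\<integral>x. x \<partial>input) \<le> (1 / \<mu> - exp (- \<mu>) / q) * A"
    unfolding input_def using T_mean by (subst integral_distr) simp_all
qed simp

end

theorem theorem1:
  fixes \<sigma> A \<alpha> \<mu>s :: real
  assumes "\<sigma> > 0" and "A > 0" and "0 < \<alpha>" and "\<alpha> < 1/2"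
    and "\<mu>s > 0" and "\<alpha> = 1 / \<mu>s - exp (- \<mu>s) / (1 - exp (- \<mu>s))"
  shows "capacity \<sigma> A (\<alpha> * A) \<ge>
           ereal (1/2 * ln (1 + A\<^sup>2 * exp (2 * \<alpha> * \<mu>s) / (2 * pi * exp 1 * \<sigma>\<^sup>2)
                                 * ((1 - exp (- \<mu>s)) / \<mu>s)\<^sup>2))
       \<and> capacity \<sigma> A (\<alpha> * A) \<le> ereal (1/2 * ln (1 + \<alpha> * (1 - \<alpha>) * A\<^sup>2 / \<sigma>\<^sup>2))
       \<and> (\<forall>\<mu> \<delta>. \<mu> > 0 \<longrightarrow> \<delta> > 0 \<longrightarrow>
         capacity \<sigma> A (\<alpha> * A) \<le> ereal (
           (1 - Qfun ((\<delta> + \<alpha> * A) / \<sigma>) - Qfun ((\<delta> + (1 - \<alpha>) * A) / \<sigma>))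
             * ln (A / \<sigma> * (exp (\<mu> * \<delta> / A) - exp (- \<mu> * (1 + \<delta> / A)))
                   / (sqrt (2 * pi) * \<mu> * (1 - 2 * Qfun (\<delta> / \<sigma>))))
           - 1/2 + Qfun (\<delta> / \<sigma>) + \<delta> / (sqrt (2 * pi) * \<sigma>) * exp (- \<delta>\<^sup>2 / (2 * \<sigma>\<^sup>2))
           + \<sigma> / A * \<mu> / sqrt (2 * pi) * (exp (- \<delta>\<^sup>2 / (2 * \<sigma>\<^sup>2)) - exp (- (A + \<delta>)\<^sup>2 / (2 * \<sigma>\<^sup>2)))
           + \<mu> * \<alpha> * (1 - 2 * Qfun ((\<delta> + A / 2) / \<sigma>))))"
proof (intro conjI allI impI)
  interpret E: truncated_exponential \<sigma> A \<mu>s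
    using assms by unfold_locales
  \<comment> \<open>The defining equation of the parameter says that the truncated exponential input
    has mean exactly \<alpha> A.\<close>
  have alpha: "1 / \<mu>s - exp (- \<mu>s) / E.q = \<alpha>" using assms(6) by (simp add: E.q_def)
  define \<kappa> where "\<kappa> = A * E.q / \<mu>s"
  have kappa: "0 < \<kappa>" using assms(2,5) E.q_bounds by (simp add: \<kappa>_def)
  \<comment> \<open>The subtracted ln (2 pi) + 1 is twice the entropy of the standard Gaussian;
    exponentiated, it becomes the 2 pi e in the denominator.\<close>
  have "2 * (\<integral>u. ln (E.T' u) \<partial>noise 1) = 2 * ln \<kappa> + 2 * \<alpha> * \<mu>s - (ln (2 * pi) + 1)"
    unfolding E.ln_T'_mean alpha \<kappa>_def[symmetric] by (simp add: algebra_simps)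
  moreover have "exp (2 * ln \<kappa>) = \<kappa>\<^sup>2"
    unfolding exp_double using kappa by (simp only: exp_ln)
  ultimately have "exp (2 * (\<integral>u. ln (E.T' u) \<partial>noise 1)) = \<kappa>\<^sup>2 * exp (2 * \<alpha> * \<mu>s) / (2 * pi * exp 1)"
    by (simp only: exp_add exp_diff exp_ln pi_gt_zero mult_pos_pos zero_less_numeral)
  moreover have "\<kappa>\<^sup>2 = A\<^sup>2 * ((1 - exp (- \<mu>s)) / \<mu>s)\<^sup>2"
    by (simp add: \<kappa>_def E.q_def power_mult_distrib power_divide)
  ultimately have rho: "exp (2 * (\<integral>u. ln (E.T' u) \<partial>noise 1)) / \<sigma>\<^sup>2
    = A\<^sup>2 * exp (2 * \<alpha> * \<mu>s) / (2 * pi * exp 1 * \<sigma>\<^sup>2) * ((1 - exp (- \<mu>s)) / \<mu>s)\<^sup>2"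
    by simp
  show "ereal (1/2 * ln (1 + A\<^sup>2 * exp (2 * \<alpha> * \<mu>s) / (2 * pi * exp 1 * \<sigma>\<^sup>2)
      * ((1 - exp (- \<mu>s)) / \<mu>s)\<^sup>2)) \<le> capacity \<sigma> A (\<alpha> * A)"
    unfolding capacity_def
  proof (rule SUP_upper2)
    show "E.input \<in> {P. admissible_input A (\<alpha> * A) P}"
      using E.input_admissible unfolding alpha by simp
    show "ereal (1/2 * ln (1 + A\<^sup>2 * exp (2 * \<alpha> * \<mu>s) / (2 * pi * exp 1 * \<sigma>\<^sup>2)
      * ((1 - exp (- \<mu>s)) / \<mu>s)\<^sup>2)) \<le> ereal (chan_MI \<sigma> E.input)"
      using E.chan_MI_entropy_power unfolding rho by simp
  qed
next
  show "capacity \<sigma> A (\<alpha> * A) \<le> ereal (1/2 * ln (1 + \<alpha> * (1 - \<alpha>) * A\<^sup>2 / \<sigma>\<^sup>2))"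
    unfolding capacity_def
    by (intro SUP_least) (simp only: mem_Collect_eq ereal_less_eq(3) chan_MI_variance_bound[OF assms(1-4)])
next
  fix \<mu> \<delta> :: real
  assume "\<mu> > 0" "\<delta> > 0"
  note bound = chan_MI_exponential_bound[OF assms(1-4) this]
  show "capacity \<sigma> A (\<alpha> * A) \<le> ereal (
           (1 - Qfun ((\<delta> + \<alpha> * A) / \<sigma>) - Qfun ((\<delta> + (1 - \<alpha>) * A) / \<sigma>))
             * ln (A / \<sigma> * (exp (\<mu> * \<delta> / A) - exp (- \<mu> * (1 + \<delta> / A)))
                   / (sqrt (2 * pi) * \<mu> * (1 - 2 * Qfun (\<delta> / \<sigma>))))
           - 1/2 + Qfun (\<delta> / \<sigma>) + \<delta> / (sqrt (2 * pi) * \<sigma>) * exp (- \<delta>\<^sup>2 / (2 * \<sigma>\<^sup>2))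
           + \<sigma> / A * \<mu> / sqrt (2 * pi) * (exp (- \<delta>\<^sup>2 / (2 * \<sigma>\<^sup>2)) - exp (- (A + \<delta>)\<^sup>2 / (2 * \<sigma>\<^sup>2)))
           + \<mu> * \<alpha> * (1 - 2 * Qfun ((\<delta> + A / 2) / \<sigma>)))"
    unfolding capacity_def
    by (intro SUP_least) (simp only: mem_Collect_eq ereal_less_eq(3) bound)
qed

end
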